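(* Let $2 \le d < \infty$ be an integer. The code $\mathcal{C}_{(2,d,d)}$ (defined in the context) has embedding dimension vector equal to $(2,d,d)$; that is, $\operatorname{odim}(\mathcal{C}_{(2,d,d)}) = 2$, $\operatorname{cdim}(\mathcal{C}_{(2,d,d)}) = d$, and $\operatorname{nddim}(\mathcal{C}_{(2,d,d)}) = d$.
   Context: A code is a collection $\mathcal{C} \subseteq 2^{S}$ of subsets of a finite set $S$, where $S$ is called a base set for $\mathcal{C}$; its elements are called codewords. By convention $\emptyset$ is a codeword of every code. Write $[d] = \{1,\dots,d\}$. For a collection $\mathcal{U} = \{U_i\}_{i \in S}$ of subsets of $\mathbb{R}^m$ indexed by $S$ (sets in the collection may be empty), the code of $\mathcal{U}$ is $$\operatorname{code}(\mathcal{U}) = \{\sigma \subseteq S \mid \text{there exists } p \in \mathbb{R}^m \text{ such that } p \in U_i \text{ if and only if } i \in \sigma\},$$ and $\mathcal{U}$ is called a realization of $\operatorname{code}(\mathcal{U})$. A realization is open (resp. closed) convex if all sets in it are convex and open (resp. convex and closed) in $\mathbb{R}^m$. A collection $\mathcal{U} = \{U_i\}$ of convex open sets is non-degenerate if $\operatorname{code}(\{\operatorname{cl}(U_i)\}) = \operatorname{code}(\mathcal{U})$. A collection $\mathcal{X} = \{X_i\}$ of closed convex sets is non-degenerate if $\operatorname{code}(\{\operatorname{int}(X_i)\}) = \operatorname{code}(\mathcal{X})$. Here $\operatorname{cl}$ and $\operatorname{int}$ denote closure and interior in $\mathbb{R}^m$. The embedding dimensions of $\mathcal{C}$ are defined as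 follows, with the minimum (over integers $m \ge 0$) of the empty set equal to $\infty$: - $\operatorname{odim}(\mathcal{C}) = \min\{m \mid \mathcal{C}$ has an open convex realization in $\mathbb{R}^m\}$; - $\operatorname{cdim}(\mathcal{C}) = \min\{m \mid \mathcal{C}$ has a closed convex realization in $\mathbb{R}^m\}$; - $\operatorname{nddim}(\mathcal{C}) = \min\{m \mid \mathcal{C}$ has a non-degenerate (open or closed) convex realization in $\mathbb{R}^m\}$. The embedding dimension vector of $\mathcal{C}$ is the triple $(\operatorname{odim}(\mathcal{C}), \operatorname{cdim}(\mathcal{C}), \operatorname{nddim}(\mathcal{C}))$. The code $\mathcal{C}_{(2,d,d)}$: for $2 \le d < \infty$, take $4d$ distinct formal symbols $\alpha_i, \beta_i, \gamma_i, \delta_i$ ($i \in [d]$), and write $\alpha_{[d]} = \{\alpha_1,\dots,\alpha_d\}$ and similarly $\beta_{[d]}, \gamma_{[d]}, \delta_{[d]}$. Then $\mathcal{C}_{(2,d,d)}$ is the code on the base set $\alpha_{[d]} \cup \beta_{[d]} \cup \gamma_{[d]} \cup \delta_{[d]}$ consisting of $\emptyset$ and exactly the following nonempty codewords: (i) $\{\beta_i, \gamma_i\}$ for $i \in [d]$; (ii) $\{\beta_i, \beta_{i+1}, \gamma_i\}$ for $i \in [d-1]$; (iii) $\{\beta_i, \beta_{i+1}\}$ for $i \in [d-1]$; (iv) $\{\beta_i, \beta_{i+1}, \gamma_{i+1}\}$ for $i \in [d-1]$; (v) $\{\alpha_i, \beta_i, \gamma_i, \delta_i\}$ for $i \in [d]$;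 (vi) $\{\alpha_i, \delta_i\}$ for $i \in [d]$; (vii) $\alpha_{[d]} \cup \delta_{[d]}$; (viii) $\delta_{[d]}$. *)

theory Defs
  imports "HOL-Analysis.Analysis" "HOL-Library.Extended_Nat"
begin

text \<open>
  The embedding dimensions minimise over the ambient dimension, so \<open>\<real>\<^sup>m\<close> has to depend on a
  natural number \<open>m\<close>. It is the library's \<^const>\<open>Euclidean_space\<close> \<open>m\<close>: sequences of reals
  that vanish from index \<open>m\<close> on, with coordinates indexed by \<open>0, \<dots>, m - 1\<close> and the topology of
  coordinatewise convergence; \<open>m = 0\<close> gives a single point.

  Sequences carry no \<^class>\<open>real_vector\<close> instance, so the library's \<^const>\<open>convex\<close> does not
  apply to them; the following is the same condition with the vector operations written
  coordinatewise.
\<close>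

definition seq_convex :: "(nat \<Rightarrow> real) set \<Rightarrow> bool" where
  "seq_convex X \<longleftrightarrow>
     (\<forall>x\<in>X. \<forall>y\<in>X. \<forall>u\<ge>0. \<forall>v\<ge>0. u + v = 1 \<longrightarrow> (\<lambda>i. u * x i + v * y i) \<in> X)"

text \<open>
  Only the values of \<open>U\<close> on \<open>S\<close> matter. The empty codeword is not added by hand: it belongs to
  the code of \<open>U\<close> exactly if the sets \<open>U i\<close> do not cover the space.
\<close>

definition code_of :: "nat \<Rightarrow> 'a set \<Rightarrow> ('a \<Rightarrow> (nat \<Rightarrow> real) set) \<Rightarrow> 'a set set" where
  "code_of m S U =
     {\<sigma>. \<sigma> \<subseteq> S \<and> (\<exists>p \<in> topspace (Euclidean_space m). \<forall>i\<in>S. p \<in> U i \<longleftrightarrow> i \<in> \<sigma>)}"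

definition open_convex_family :: "nat \<Rightarrow> 'a set \<Rightarrow> ('a \<Rightarrow> (nat \<Rightarrow> real) set) \<Rightarrow> bool" where
  "open_convex_family m S U \<longleftrightarrow> (\<forall>i\<in>S. openin (Euclidean_space m) (U i) \<and> seq_convex (U i))"

definition closed_convex_family :: "nat \<Rightarrow> 'a set \<Rightarrow> ('a \<Rightarrow> (nat \<Rightarrow> real) set) \<Rightarrow> bool" where
  "closed_convex_family m S X \<longleftrightarrow> (\<forall>i\<in>S. closedin (Euclidean_space m) (X i) \<and> seq_convex (X i))"

definition open_nondegenerate :: "nat \<Rightarrow> 'a set \<Rightarrow> ('a \<Rightarrow> (nat \<Rightarrow> real) set) \<Rightarrow> bool" where
  "open_nondegenerate m S U \<longleftrightarrow>
     code_of m S (\<lambda>i. Euclidean_space m closure_of U i) = code_of m S U"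

definition closed_nondegenerate :: "nat \<Rightarrow> 'a set \<Rightarrow> ('a \<Rightarrow> (nat \<Rightarrow> real) set) \<Rightarrow> bool" where
  "closed_nondegenerate m S X \<longleftrightarrow>
     code_of m S (\<lambda>i. Euclidean_space m interior_of X i) = code_of m S X"

text \<open>
  In the embedding dimensions, \<open>S\<close> is the base set and \<open>C\<close> the set of codewords. On
  \<^typ>\<open>enat\<close>, \<^const>\<open>Inf\<close> is the minimum of a nonempty set, and \<open>\<infinity>\<close> for the empty set.
\<close>

definition odim :: "'a set \<Rightarrow> 'a set set \<Rightarrow> enat" where
  "odim S C = Inf {enat m | m. \<exists>U. open_convex_family m S U \<and> code_of m S U = C}"

definition cdim :: "'a set \<Rightarrow> 'a set set \<Rightarrow> enat" where
  "cdim S C = Inf {enat m | m. \<exists>X. closed_convex_family m S X \<and> code_of m S X = C}"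

definition nddim :: "'a set \<Rightarrow> 'a set set \<Rightarrow> enat" where
  "nddim S C = Inf {enat m | m.
     (\<exists>U. open_convex_family m S U \<and> open_nondegenerate m S U \<and> code_of m S U = C) \<or>
     (\<exists>X. closed_convex_family m S X \<and> closed_nondegenerate m S X \<and> code_of m S X = C)}"

definition embedding_dim_vector :: "'a set \<Rightarrow> 'a set set \<Rightarrow> enat \<times> enat \<times> enat" where
  "embedding_dim_vector S C = (odim S C, cdim S C, nddim S C)"

datatype symb = Alpha nat | Beta nat | Gamma nat | Delta nat

definition base_2dd :: "nat \<Rightarrow> symb set" where
  "base_2dd d = Alpha ` {1..d} \<union> Beta ` {1..d} \<union> Gamma ` {1..d} \<union> Delta ` {1..d}"

definition code_2dd :: "nat \<Rightarrow> symb set set" where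
  "code_2dd d =
     {{}}
     \<union> {{Beta i, Gamma i} | i. i \<in> {1..d}}
     \<union> {{Beta i, Beta (i + 1), Gamma i} | i. i \<in> {1..d - 1}}
     \<union> {{Beta i, Beta (i + 1)} | i. i \<in> {1..d - 1}}
     \<union> {{Beta i, Beta (i + 1), Gamma (i + 1)} | i. i \<in> {1..d - 1}}
     \<union> {{Alpha i, Beta i, Gamma i, Delta i} | i. i \<in> {1..d}}
     \<union> {{Alpha i, Delta i} | i. i \<in> {1..d}}
     \<union> {Alpha ` {1..d} \<union> Delta ` {1..d}}
     \<union> {Delta ` {1..d}}"

lemma finite_base_2dd: "finite (base_2dd d)"
  by (simp add: base_2dd_def)

lemma code_2dd_subset_Pow: "code_2dd d \<subseteq> Pow (base_2dd d)"
  by (auto simp: code_2dd_def base_2dd_def)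

end

theory Submission
  imports Defs "HOL-Library.Function_Algebras"
begin

text \<open>
  \<^bold>\<open>Why the closed and the non-degenerate dimension are at least \<open>d\<close>.\<close> Write \<open>A\<^sub>i, B\<^sub>i, G\<^sub>i, D\<^sub>i\<close> for
  the sets of a closed convex realization in \<open>\<real>\<^sup>m\<close>. The sets \<open>B\<^sub>1, \<dots>, B\<^sub>d\<close> form a chain, and the
  disjoint closed sets \<open>G\<^sub>i\<close> keep the private part of \<open>B\<^sub>i\<close> away from that of \<open>B\<^sub>i\<^sub>+\<^sub>1\<close>; this
  makes \<open>B\<^sub>1 \<union> \<dots> \<union> B\<^sub>d\<close> locally convex and therefore convex (\<open>closed_convex_Un\<close>,
  \<open>convex_Union_Beta\<close>). The sets \<open>D\<^sub>i\<close> form a sunflower: any two of them meet in the same center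
  \<open>E\<close>, outside which they have disjoint petals \<open>D\<^sub>i - E\<close>, and \<open>E\<close> is disjoint
  from the chain. A point \<open>f\<close> with codeword \<open>\<delta>\<^bsub>[d]\<^esub>\<close> lies outside the closed sets \<open>A\<^sub>i\<close>, so near \<open>f\<close> all \<open>D\<^sub>i\<close> coincide with \<open>E\<close>. Choose \<open>w\<^sub>i \<in> B\<^sub>i \<inter> D\<^sub>i\<close>. The hull of the \<open>w\<^sub>i\<close>
  lies in the chain and misses \<open>E\<close>. By \<open>dependent_petals_hull_meets_center\<close> this is possible only if
  the vectors \<open>w\<^sub>i - f\<close> are linearly independent, whence \<open>d \<le> m\<close>. The closures of a non-degenerate
  open realization form a closed realization, so the bound holds for \<open>nddim\<close> as well.

  The sunflower lemma has an elementary proof. A linear dependence of the \<open>w\<^sub>i - f\<close> gives a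
  Radon point \<open>x\<close> (taking \<open>f\<close> as the origin), a positive combination of the \<open>w\<^sub>i\<close> with \<open>i \<in> P\<close> and
  also of those with \<open>i \<in> N\<close>, for disjoint \<open>P\<close> and \<open>N\<close>. Start with a large multiple of \<open>x\<close> and
  repeatedly take away one summand \<open>\<lambda>\<^sub>i w\<^sub>i\<close>, at the price \<open>\<lambda>\<^sub>i\<close> in the scaling factor. If \<open>y - \<lambda>\<^sub>i w\<^sub>i\<close>
  lies in \<open>c E\<close>, then \<open>y\<close> lies in \<open>(c + \<lambda>\<^sub>i) D\<^sub>i\<close>; knowing this for one \<open>i \<in> P\<close> and one \<open>j \<in> N\<close> puts \<open>y\<close>
  into a multiple of \<open>D\<^sub>i \<inter> D\<^sub>j = E\<close>. Taking away all of \<open>P\<close>, or all of \<open>N\<close>, removes one copy of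
  \<open>x\<close> for a total price of at most \<open>1\<close>, up to a bounded error, and so \<open>x\<close> itself lies in the
  closed set \<open>E\<close>.

  \<^bold>\<open>Why the open dimension is at least 2.\<close> On a line, points with codewords \<open>\<alpha>\<^sub>1\<delta>\<^sub>1\<close> and \<open>\<alpha>\<^sub>2\<delta>\<^sub>2\<close>
  lie on different sides of \<open>E\<close>; a point of \<open>A\<^sub>1 \<inter> A\<^sub>2\<close> lies between them, so \<open>A\<^sub>1\<close> and \<open>A\<^sub>2\<close>
  together cover \<open>E\<close>, which leaves no room for the codeword \<open>\<delta>\<^bsub>[d]\<^esub>\<close>.

  \<^bold>\<open>Realizations.\<close> In the plane, let \<open>E\<close> be the polygon below the tangents of the parabola
  \<open>y = - x\<^sup>2\<close> at \<open>x = 0, \<dots>, d + 1\<close>, let \<open>D\<^sub>i\<close> be obtained by dropping the tangent at \<open>i\<close>, and let \<open>B\<^sub>i\<close>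
  be a piece of the half-plane above that tangent. Open sets \<open>B\<^sub>i\<close> may bend around the polygon at the
  vertices, where neighbouring tangents cross (\<open>open_plane_realization\<close>). In \<open>\<real>\<^sup>d\<close>, take for \<open>E\<close> the cube
  \<open>[-1, 0]\<^sup>d\<close>, for \<open>D\<^sub>i\<close> the box obtained by prolonging the cube in the positive \<open>i\<close>-th direction,
  and cut the chain out of a half-space that contains only the far ends of these boxes
  (\<open>closed_slab_realization\<close>).
\<close>

section \<open>Real sequences as a vector space\<close>

text \<open>
  With the pointwise vector space structure, convexity, hulls, spans and linear maps are the
  library's notions.
\<close>

instantiation "fun" :: (type, real_vector) real_vector
begin

definition scaleR_fun where "r *\<^sub>R f = (\<lambda>x. r *\<^sub>R f x)"

instance
  by standard (auto simp: scaleR_fun_def fun_eq_iff algebra_simps)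

end

lemma seq_convex_iff_convex: "seq_convex X \<longleftrightarrow> convex X"
  by (simp add: seq_convex_def convex_def scaleR_fun_def plus_fun_def)

section \<open>Sunflowers of convex sets\<close>

lemma dependent_family_obtain:
  fixes w :: "'i \<Rightarrow> 'v::real_vector"
  assumes "finite I" "finite B" "card B < card I" "w ` I \<subseteq> span B"
  obtains c where "\<exists>i\<in>I. c i \<noteq> 0" "(\<Sum>i\<in>I. c i *\<^sub>R w i) = 0"
proof (cases "inj_on w I")
  case True
  have "dependent (w ` I)"
  proof (rule ccontr)
    assume "independent (w ` I)"
    then have "card (w ` I) \<le> card B"
      using independent_span_bound[OF assms(2)] assms(4) by blast
    then show False using True assms(3) by (simp add: card_image)
  qed
  then obtain u where u: "\<exists>v\<in>w ` I. u v \<noteq> 0" "(\<Sum>v\<in>w ` I. u v *\<^sub>R v) = 0"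
    using dependent_finite[of "w ` I"] assms(1) by auto
  show ?thesis
    by (rule that[of "u \<circ> w"]) (use u True in \<open>auto simp: sum.reindex\<close>)
next
  case False
  then obtain i j where ij: "i \<in> I" "j \<in> I" "i \<noteq> j" "w i = w j"
    by (auto simp: inj_on_def)
  define c :: "'i \<Rightarrow> real" where "c k = (if k = i then 1 else if k = j then - 1 else 0)" for k
  have "(\<Sum>k\<in>I. c k *\<^sub>R w k) = (\<Sum>k\<in>{i, j}. c k *\<^sub>R w k)"
    by (rule sum.mono_neutral_right) (use ij assms(1) in \<open>auto simp: c_def\<close>)
  also have "\<dots> = 0" using ij by (simp add: c_def)
  finally show ?thesis
    by (intro that[of c]) (use ij in \<open>auto simp: c_def\<close>)
qed

lemma convex_subunit_sum_mem:
  fixes u :: "'i \<Rightarrow> 'v::real_vector"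
  assumes "convex E" "0 \<in> E" "finite A"
    and "\<And>i. i \<in> A \<Longrightarrow> 0 \<le> a i" "sum a A \<le> 1" "\<And>i. i \<in> A \<Longrightarrow> u i \<in> E"
  shows "(\<Sum>i\<in>A. a i *\<^sub>R u i) \<in> E"
proof -
  define b where "b = (\<lambda>j. case j of None \<Rightarrow> 1 - sum a A | Some i \<Rightarrow> a i)"
  define z where "z = (\<lambda>j. case j of None \<Rightarrow> 0 | Some i \<Rightarrow> u i)"
  have "(\<Sum>j\<in>insert None (Some ` A). b j *\<^sub>R z j) \<in> E"
    by (rule convex_sum)
       (use assms in \<open>auto simp: b_def z_def sum.reindex split: option.split\<close>)
  then show ?thesis
    using assms(3) by (simp add: b_def z_def sum.reindex)
qed

lemma shrink_mem:
  fixes E :: "'v::real_vector set"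
  assumes "convex E" "0 \<in> E" "(1 / c) *\<^sub>R y \<in> E" "0 < c" "c \<le> c'"
  shows "(1 / c') *\<^sub>R y \<in> E"
proof -
  have "(1 - c / c') *\<^sub>R 0 + (c / c') *\<^sub>R ((1 / c) *\<^sub>R y) \<in> E"
    by (rule convexD) (use assms in \<open>auto simp: field_simps\<close>)
  then show ?thesis using assms by simp
qed

text \<open>
  One step of the process of taking away summands, read backwards: adding \<open>a\<close> times a point of \<open>D\<close> to a point of \<open>c D\<close> gives a point of
  \<open>(c + a) D\<close>.
\<close>

lemma petal_step:
  fixes D :: "'v::real_vector set"
  assumes "convex D" "w \<in> D" "(1 / c) *\<^sub>R (y - a *\<^sub>R w) \<in> D" "0 < c" "0 < a"
  shows "(1 / (c + a)) *\<^sub>R y \<in> D"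
proof -
  have "(c / (c + a)) *\<^sub>R ((1 / c) *\<^sub>R (y - a *\<^sub>R w)) + (a / (c + a)) *\<^sub>R w \<in> D"
    by (rule convexD) (use assms in \<open>auto simp flip: add_divide_distrib\<close>)
  moreover have "(c / (c + a)) *\<^sub>R ((1 / c) *\<^sub>R (y - a *\<^sub>R w)) + (a / (c + a)) *\<^sub>R w
      = (1 / (c + a)) *\<^sub>R y"
    using assms(4,5) by (simp add: scaleR_diff_right)
  ultimately show ?thesis by simp
qed

text \<open>
  The core of the lower bound. The inductive claim \<open>game\<close> is that
  \<open>T x + v(A) + v(B)\<close> lies in \<open>(T + l(A) + l(B) + K) E\<close> for all nonempty remainders \<open>A \<subseteq> P\<close> and
  \<open>B \<subseteq> N\<close>, where \<open>v i = l i w i\<close>. To prove it, take away \<open>v i\<close> for some \<open>i \<in> A\<close>, and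
  independently \<open>v j\<close> for some \<open>j \<in> B\<close>: the first puts the point into a multiple of \<open>D i\<close>, the second
  into the same multiple of \<open>D j\<close>, hence into a multiple of \<open>E\<close>. When a remainder becomes empty, one
  copy of \<open>x\<close> is exchanged for a full set \<open>P\<close> or \<open>N\<close>. The scaling factors are
  right because \<open>l(P) = 1\<close> and \<open>l(N) \<le> 1\<close>, and the constant \<open>K\<close> absorbs what is left at the end.
  Letting \<open>T\<close> grow shows that \<open>x\<close> is a limit of points of \<open>E\<close> on its own ray.
\<close>

lemma radon_point_mem_center:
  fixes D :: "'i \<Rightarrow> 'v::real_vector set" and w :: "'i \<Rightarrow> 'v"
  assumes fin: "finite P" "finite N" and ne: "P \<noteq> {}" "N \<noteq> {}"
    and conv: "\<And>i. i \<in> P \<union> N \<Longrightarrow> convex (D i)"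
    and sunflower: "\<And>i j. i \<in> P \<Longrightarrow> j \<in> N \<Longrightarrow> D i \<inter> D j = E"
    and zero: "0 \<in> E"
    and w: "\<And>i. i \<in> P \<union> N \<Longrightarrow> w i \<in> D i"
    and absorb: "\<And>i. i \<in> P \<union> N \<Longrightarrow> \<exists>t>0. t *\<^sub>R w i \<in> E"
    and pos: "\<And>i. i \<in> P \<union> N \<Longrightarrow> 0 < l i"
    and eq: "(\<Sum>i\<in>P. l i *\<^sub>R w i) = x" "(\<Sum>i\<in>N. l i *\<^sub>R w i) = x"
    and sums: "sum l P = 1" "sum l N \<le> 1"
    and ray: "(\<And>s. 0 \<le> s \<Longrightarrow> s < 1 \<Longrightarrow> s *\<^sub>R x \<in> E) \<Longrightarrow> x \<in> E"
  shows "x \<in> E"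
proof -
  obtain i0 j0 where ij0: "i0 \<in> P" "j0 \<in> N" using ne by blast
  have convE: "convex E"
    using convex_Int[of "D i0" "D j0"] conv sunflower[OF ij0] ij0 by auto
  have E_sub: "E \<subseteq> D i" if "i \<in> P \<union> N" for i
    using that sunflower ij0 by blast
  define v where "v i = l i *\<^sub>R w i" for i
  have "\<forall>i\<in>P \<union> N. \<exists>t>0. t *\<^sub>R w i \<in> E" using absorb by blast
  then obtain t where t: "\<And>i. i \<in> P \<union> N \<Longrightarrow> 0 < t i" "\<And>i. i \<in> P \<union> N \<Longrightarrow> t i *\<^sub>R w i \<in> E"
    by metis
  define K where "K = (\<Sum>i\<in>P \<union> N. l i / t i)"
  have K_pos: "0 < K"
    unfolding K_def by (rule sum_pos) (use fin ne pos t in auto)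
  have sum_N_nonneg: "0 \<le> sum l N"
    by (rule sum_nonneg) (use pos in \<open>simp add: less_imp_le\<close>)
  (* The end of the game: a sum of some v i is bounded by the constant K alone. *)
  have base: "(1 / K) *\<^sub>R sum v A \<in> E" if "A \<subseteq> P \<union> N" for A
  proof -
    have finA: "finite A" using that fin by (meson finite_UnI finite_subset)
    have "(\<Sum>i\<in>A. (l i / t i / K) *\<^sub>R (t i *\<^sub>R w i)) \<in> E"
    proof (rule convex_subunit_sum_mem[OF convE zero finA])
      show "0 \<le> l i / t i / K" if "i \<in> A" for i
        using that \<open>A \<subseteq> P \<union> N\<close> pos t(1) K_pos by (meson divide_nonneg_pos less_imp_le subsetD)
      have "(\<Sum>i\<in>A. l i / t i) \<le> K"
        unfolding K_def
        by (rule sum_mono2) (use fin that pos t(1) in \<open>auto intro!: divide_nonneg_pos simp: less_imp_le\<close>)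
      then show "(\<Sum>i\<in>A. l i / t i / K) \<le> 1"
        using K_pos by (simp only: sum_divide_distrib[symmetric] divide_le_eq_1_pos)
    qed (use that t in auto)
    also have "(\<Sum>i\<in>A. (l i / t i / K) *\<^sub>R (t i *\<^sub>R w i)) = (1 / K) *\<^sub>R sum v A"
      unfolding scaleR_sum_right v_def
      by (rule sum.cong) (use that t(1) in force)+
    finally show ?thesis .
  qed
  have game: "(1 / (real T + sum l A + sum l B + K)) *\<^sub>R (real T *\<^sub>R x + sum v A + sum v B) \<in> E"
    if "A \<subseteq> P" "B \<subseteq> N" "A \<noteq> {}" "B \<noteq> {}" for T A B
    using that
  proof (induction "(T, card A + card B)" arbitrary: T A B rule: wf_induct_rule[OF wf_lex_prod[OF wf_less_than wf_less_than]])
    case (1 T A B)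
    obtain i j where ij: "i \<in> A" "j \<in> B" using "1.prems" by blast
    have finAB: "finite A" "finite B"
      using finite_subset[OF "1.prems"(1)] finite_subset[OF "1.prems"(2)] fin by blast+
    define y where "y = real T *\<^sub>R x + sum v A + sum v B"
    define c where "c = real T + sum l A + sum l B + K"
    have l_pos: "\<And>k. k \<in> A \<union> B \<Longrightarrow> 0 < l k" using "1.prems" pos by blast
    have split: "sum l A = l i + sum l (A - {i})" "sum l B = l j + sum l (B - {j})"
      "sum v A = v i + sum v (A - {i})" "sum v B = v j + sum v (B - {j})"
      using ij finAB by (auto simp: sum.remove)
    have card_pos: "0 < card A" "0 < card B" using ij finAB by (auto simp: card_gt_0_iff)
    have nonneg: "0 \<le> sum l (A - {i})" "0 \<le> sum l (B - {j})" "0 < sum l A" "0 < sum l B"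
      using l_pos ij finAB by (auto intro!: sum_nonneg sum_pos simp: less_imp_le)
    have c_pos: "0 < c - l i" "0 < c - l j"
      using split nonneg K_pos by (auto simp: c_def)
    (* If v i was the last summand from P, the whole of P is restored at the cost of one x. *)
    have "(1 / (c - l i)) *\<^sub>R (y - v i) \<in> E"
    proof (cases "A = {i}")
      case False
      have "(1 / (real T + sum l (A - {i}) + sum l B + K)) *\<^sub>R
          (real T *\<^sub>R x + sum v (A - {i}) + sum v B) \<in> E"
        by (rule 1) (use "1.prems" ij False finAB card_pos in auto)
      then show ?thesis using split by (simp add: y_def c_def algebra_simps)
    next
      case single: True
      show ?thesis
      proof (cases T)
        case 0
        have "(1 / (sum l B + K)) *\<^sub>R sum v B \<in> E"
          by (rule shrink_mem[OF convE zero base, of B]) (use "1.prems" K_pos nonneg in auto)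
        then show ?thesis using single 0 by (simp add: y_def c_def)
      next
        case (Suc T')
        have "(1 / (real T' + sum l P + sum l B + K)) *\<^sub>R
            (real T' *\<^sub>R x + sum v P + sum v B) \<in> E"
          by (rule 1) (use "1.prems" Suc ne in auto)
        then show ?thesis
          using single Suc sums eq by (simp add: y_def c_def v_def algebra_simps)
      qed
    qed
    then have "(1 / (c - l i + l i)) *\<^sub>R y \<in> D i"
      by (intro petal_step[where w = "w i"] conv w subsetD[OF E_sub])
         (use "1.prems" ij l_pos c_pos in \<open>auto simp: v_def\<close>)
    moreover have "(1 / (c - l j)) *\<^sub>R (y - v j) \<in> E"
    proof (cases "B = {j}")
      case False
      have "(1 / (real T + sum l A + sum l (B - {j}) + K)) *\<^sub>R
          (real T *\<^sub>R x + sum v A + sum v (B - {j})) \<in> E"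
        by (rule 1) (use "1.prems" ij False finAB card_pos in auto)
      then show ?thesis using split by (simp add: y_def c_def algebra_simps)
    next
      case single: True
      show ?thesis
      proof (cases T)
        case 0
        have "(1 / (sum l A + K)) *\<^sub>R sum v A \<in> E"
          by (rule shrink_mem[OF convE zero base, of A]) (use "1.prems" K_pos nonneg in auto)
        then show ?thesis using single 0 by (simp add: y_def c_def)
      next
        case (Suc T')
        have "(1 / (real T' + sum l A + sum l N + K)) *\<^sub>R
            (real T' *\<^sub>R x + sum v A + sum v N) \<in> E"
          by (rule 1) (use "1.prems" Suc ne in auto)
        then have "(1 / (real T' + sum l A + 1 + K)) *\<^sub>R
            (real T' *\<^sub>R x + sum v A + sum v N) \<in> E"
          by (rule shrink_mem[OF convE zero])
             (use sums nonneg K_pos sum_N_nonneg in linarith)+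
        then show ?thesis
          using single Suc eq by (simp add: y_def c_def v_def algebra_simps)
      qed
    qed
    then have "(1 / (c - l j + l j)) *\<^sub>R y \<in> D j"
      by (intro petal_step[where w = "w j"] conv w subsetD[OF E_sub])
         (use "1.prems" ij l_pos c_pos in \<open>auto simp: v_def\<close>)
    ultimately show ?case
      using sunflower[of i j] "1.prems" ij by (auto simp: y_def c_def)
  qed
  (* The factor (T + 2) / (T + 2 + K) tends to 1, so it exceeds any s < 1 for large T. *)
  show ?thesis
  proof (rule ray)
    fix s :: real assume s: "0 \<le> s" "s < 1"
    obtain T :: nat where T: "s * (K + 2) / (1 - s) < real T"
      using reals_Archimedean2 by blast
    define r where "r = (real T + 2) / (real T + 2 + K)"
    have "(1 / (real T + sum l P + sum l N + K)) *\<^sub>R (real T *\<^sub>R x + sum v P + sum v N) \<in> E"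
      by (rule game) (use ne in auto)
    then have "(1 / (real T + 2 + K)) *\<^sub>R (real T *\<^sub>R x + sum v P + sum v N) \<in> E"
      by (rule shrink_mem[OF convE zero])
         (use sums K_pos sum_N_nonneg in linarith)+
    moreover have "real T *\<^sub>R x + sum v P + sum v N = (real T + 2) *\<^sub>R x"
      using eq by (simp add: v_def algebra_simps scaleR_2)
    ultimately have "r *\<^sub>R x \<in> E" by (simp add: r_def)
    moreover have "s \<le> r" "0 < r"
      using T s K_pos by (auto simp: r_def field_simps)
    ultimately show "s *\<^sub>R x \<in> E"
      using convexD[OF convE zero, of "r *\<^sub>R x" "1 - s / r" "s / r"] s by auto
  qed
qed

text \<open>
  A linear dependence of the vectors \<open>w i - f\<close> is split by sign into \<open>P\<close> and \<open>N\<close> and scaled so that the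
  positive part has sum \<open>1\<close>. If there is no negative part, it writes \<open>f\<close> itself as a convex combination
  of the \<open>w i\<close>. Otherwise, the positive part is a convex combination of
  the \<open>w i\<close> with \<open>i \<in> P\<close> that is a Radon point as in the previous lemma.
\<close>

lemma dependent_petals_hull_meets_center:
  fixes D :: "'i \<Rightarrow> 'v::real_vector set" and w :: "'i \<Rightarrow> 'v"
  assumes fin: "finite I"
    and conv: "\<And>i. i \<in> I \<Longrightarrow> convex (D i)"
    and sunflower: "\<And>i j. i \<in> I \<Longrightarrow> j \<in> I \<Longrightarrow> i \<noteq> j \<Longrightarrow> D i \<inter> D j = E"
    and center: "f \<in> E"
    and w: "\<And>i. i \<in> I \<Longrightarrow> w i \<in> D i"
    and absorb: "\<And>i. i \<in> I \<Longrightarrow> \<exists>t>0. f + t *\<^sub>R (w i - f) \<in> E"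
    and ray: "\<And>x. (\<And>s. 0 \<le> s \<Longrightarrow> s < 1 \<Longrightarrow> f + s *\<^sub>R x \<in> E) \<Longrightarrow> f + x \<in> E"
    and dep: "\<exists>i\<in>I. c i \<noteq> 0" "(\<Sum>i\<in>I. c i *\<^sub>R (w i - f)) = 0"
  shows "convex hull (w ` I) \<inter> E \<noteq> {}"
proof -
  (* Replacing c by its negative if necessary, the coefficients have a nonnegative sum. *)
  define a where "a i = (if 0 \<le> sum c I then c i else - c i)" for i
  have a: "\<exists>i\<in>I. a i \<noteq> 0" "(\<Sum>i\<in>I. a i *\<^sub>R (w i - f)) = 0" "0 \<le> sum a I"
    using dep by (cases "0 \<le> sum c I"; simp add: a_def[abs_def] sum_negf)+
  define P where "P = {i \<in> I. 0 < a i}"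
  define N where "N = {i \<in> I. a i < 0}"
  have PN: "finite P" "finite N" "P \<inter> N = {}" "P \<subseteq> I" "N \<subseteq> I"
    using fin by (auto simp: P_def N_def)
  have sum_PN: "(\<Sum>i\<in>I. g i) = (\<Sum>i\<in>P. g i) + (\<Sum>i\<in>N. g i)"
    if "\<And>i. a i = 0 \<Longrightarrow> g i = 0" for g :: "'i \<Rightarrow> 'x::ab_group_add"
  proof -
    have "a i = 0" if "i \<in> I - (P \<union> N)" for i
      using that by (auto simp: P_def N_def not_less)
    then have "(\<Sum>i\<in>I. g i) = (\<Sum>i\<in>P \<union> N. g i)"
      by (intro sum.mono_neutral_right) (use fin that PN in auto)
    then show ?thesis using PN by (simp add: sum.union_disjoint)
  qed
  have "P \<noteq> {}"
  proof
    assume "P = {}"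
    then have "N \<noteq> {}" using a(1) by (auto simp: P_def N_def neq_iff)
    then have "0 < (\<Sum>i\<in>N. - a i)"
      by (intro sum_pos) (use PN in \<open>auto simp: N_def\<close>)
    then have "sum a N < 0" by (simp add: sum_negf)
    then show False using a(3) sum_PN[of a] \<open>P = {}\<close> by simp
  qed
  define \<sigma> where "\<sigma> = sum a P"
  have "0 < \<sigma>"
    unfolding \<sigma>_def by (rule sum_pos) (use PN \<open>P \<noteq> {}\<close> in \<open>auto simp: P_def\<close>)
  define l where "l i = \<bar>a i\<bar> / \<sigma>" for i
  have l_P: "l i = a i / \<sigma>" if "i \<in> P" for i using that by (simp add: l_def P_def)
  have l_N: "l i = - (a i / \<sigma>)" if "i \<in> N" for i using that by (simp add: l_def N_def)
  have sum_l: "sum l P = 1" "sum l N \<le> 1"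
  proof -
    have "sum l P = \<sigma> / \<sigma>"
      unfolding \<sigma>_def sum_divide_distrib by (rule sum.cong) (simp_all add: l_P \<sigma>_def)
    then show "sum l P = 1" using \<open>0 < \<sigma>\<close> by simp
    have "sum l N = (- sum a N) / \<sigma>"
      unfolding sum_negf[symmetric] sum_divide_distrib by (rule sum.cong) (simp_all add: l_N)
    moreover have "- sum a N \<le> \<sigma>" using a(3) sum_PN[of a] by (simp add: \<sigma>_def)
    ultimately show "sum l N \<le> 1" using \<open>0 < \<sigma>\<close> by (simp only: divide_le_eq_1_pos)
  qed
  define x where "x = (\<Sum>i\<in>P. l i *\<^sub>R (w i - f))"
  have fx: "f + x = (\<Sum>i\<in>P. l i *\<^sub>R w i)"
    using sum_l by (simp add: x_def scaleR_diff_right sum_subtractf flip: scaleR_sum_left)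
  have "(\<Sum>i\<in>P. l i *\<^sub>R w i) \<in> convex hull (w ` I)"
    by (rule convex_sum) (use PN sum_l \<open>0 < \<sigma>\<close> in \<open>auto simp: l_def intro!: hull_inc\<close>)
  then have hull: "f + x \<in> convex hull (w ` I)" by (simp add: fx)
  have "(\<Sum>i\<in>P. a i *\<^sub>R (w i - f)) + (\<Sum>i\<in>N. a i *\<^sub>R (w i - f)) = 0"
    using a(2) sum_PN[of "\<lambda>i. a i *\<^sub>R (w i - f)"] by simp
  then have "(\<Sum>i\<in>N. - (a i *\<^sub>R (w i - f))) = (\<Sum>i\<in>P. a i *\<^sub>R (w i - f))"
    by (simp add: sum_negf add_eq_0_iff)
  moreover have "(\<Sum>i\<in>N. l i *\<^sub>R (w i - f)) = (1 / \<sigma>) *\<^sub>R (\<Sum>i\<in>N. - (a i *\<^sub>R (w i - f)))"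
    unfolding scaleR_sum_right by (rule sum.cong) (simp_all add: l_N)
  moreover have "x = (1 / \<sigma>) *\<^sub>R (\<Sum>i\<in>P. a i *\<^sub>R (w i - f))"
    unfolding x_def scaleR_sum_right by (rule sum.cong) (simp_all add: l_P)
  ultimately have N_eq: "(\<Sum>i\<in>N. l i *\<^sub>R (w i - f)) = x" by simp
  have "f + x \<in> E"
  proof (cases "N = {}")
    case True
    then show ?thesis using N_eq center by simp
  next
    case False
    have "x \<in> (+) f -` E"
    proof (rule radon_point_mem_center[where P = P and N = N and D = "\<lambda>i. (+) f -` D i"
          and w = "\<lambda>i. w i - f" and l = l])
      show "convex ((+) f -` D i)" if "i \<in> P \<union> N" for i
      proof -
        have "(+) f -` D i = (+) (- f) ` D i"
        proof (intro set_eqI iffI)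
          fix z assume "z \<in> (+) f -` D i"
          then show "z \<in> (+) (- f) ` D i" by (intro image_eqI[of _ _ "f + z"]) auto
        qed auto
        then show ?thesis using conv that PN by (auto intro: convex_translation)
      qed
      show "(+) f -` D i \<inter> (+) f -` D j = (+) f -` E" if "i \<in> P" "j \<in> N" for i j
      proof -
        have "i \<noteq> j" "i \<in> I" "j \<in> I" using that PN by auto
        then show ?thesis using sunflower[of i j] by blast
      qed
      show "w i - f \<in> (+) f -` D i" if "i \<in> P \<union> N" for i
        using that PN w by auto
      show "\<exists>t>0. t *\<^sub>R (w i - f) \<in> (+) f -` E" if "i \<in> P \<union> N" for i
      proof -
        have "i \<in> I" using that PN by blast
        from absorb[OF this] show ?thesis by simp
      qed
      show "0 < l i" if "i \<in> P \<union> N" for i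
        using that \<open>0 < \<sigma>\<close> by (auto simp: l_def P_def N_def divide_neg_pos)
      show "x \<in> (+) f -` E" if "\<And>s. 0 \<le> s \<Longrightarrow> s < 1 \<Longrightarrow> s *\<^sub>R x \<in> (+) f -` E"
        using ray[of x] that by simp
      show "0 \<in> (+) f -` E" using center by simp
    qed (simp_all add: PN \<open>P \<noteq> {}\<close> False sum_l N_eq x_def)
    then show ?thesis by simp
  qed
  with hull show ?thesis by blast
qed

section \<open>Unions of closed convex sets\<close>

lemma continuous_on_affine_seq:
  fixes x y z :: "nat \<Rightarrow> real"
  shows "continuous_on A (\<lambda>p. x + fst p *\<^sub>R y + snd p *\<^sub>R z)"
  by (rule continuous_on_coordinatewise_then_product)
     (auto simp: scaleR_fun_def intro!: continuous_intros)

lemma continuous_on_line_seq: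
  fixes x y :: "nat \<Rightarrow> real"
  shows "continuous_on A (\<lambda>t. x + t *\<^sub>R y)"
  by (rule continuous_on_coordinatewise_then_product)
     (auto simp: scaleR_fun_def intro!: continuous_intros)

lemma segment_leaves_closed:
  fixes c x :: "nat \<Rightarrow> real"
  assumes "closed G" "c \<notin> G"
  obtains s where "0 < s" "s \<le> 1" "c + s *\<^sub>R (x - c) \<notin> G"
proof -
  have "open ((\<lambda>t. c + t *\<^sub>R (x - c)) -` (- G))"
    by (rule open_vimage) (use assms continuous_on_line_seq in auto)
  moreover have "0 \<in> (\<lambda>t. c + t *\<^sub>R (x - c)) -` (- G)" using assms by simp
  ultimately obtain e where e: "0 < e" "ball (0::real) e \<subseteq> (\<lambda>t. c + t *\<^sub>R (x - c)) -` (- G)"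
    using openE by blast
  then have "min 1 (e / 2) \<in> ball 0 e" by auto
  then have "c + min 1 (e / 2) *\<^sub>R (x - c) \<notin> G" using e by blast
  then show ?thesis using e by (intro that[of "min 1 (e / 2)"]) auto
qed

text \<open>
  This is an elementary instance of the theorem that closed, connected, locally convex sets are
  convex. Given \<open>x \<in> P\<close> and \<open>y \<in> Q\<close>, the triangle spanned by \<open>x\<close>, \<open>y\<close> and a common point \<open>z\<close>
  contains a point \<open>c\<close> of \<open>P \<inter> Q\<close> that is nearest to the side from \<open>x\<close> to \<open>y\<close>, in the sense that its
  barycentric weight at \<open>z\<close> is minimal. As \<open>c\<close> is
  outside \<open>G\<close> or outside \<open>H\<close>, a small step from \<open>c\<close> towards \<open>x\<close> stays in \<open>Q\<close>, or one towards \<open>y\<close>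
  stays in \<open>P\<close>. Such a step leads to a point of \<open>P \<inter> Q\<close> that is nearer to the side, so \<open>c\<close> is on
  the side and divides it into a part in \<open>P\<close> and a part in \<open>Q\<close>.
\<close>

lemma closed_convex_Un:
  fixes P Q :: "(nat \<Rightarrow> real) set"
  assumes P: "closed P" "convex P" and Q: "closed Q" "convex Q"
    and G: "closed G" "P - Q \<subseteq> G" and H: "closed H" "Q - P \<subseteq> H"
    and GH: "G \<inter> H = {}" and meet: "P \<inter> Q \<noteq> {}"
  shows "convex (P \<union> Q)"
proof -
  have main: "\<exists>b. 0 \<le> b \<and> b \<le> 1 \<and> (1 - b) *\<^sub>R x + b *\<^sub>R y \<in> P \<inter> Q" if x: "x \<in> P" and y: "y \<in> Q" for x y
  proof -
    obtain z where z: "z \<in> P \<inter> Q" using meet by blast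
    (* Coordinates (a, b) in the triangle; the side from x to y is given by a + b = 1. *)
    define h where "h p = z + fst p *\<^sub>R (x - z) + snd p *\<^sub>R (y - z)" for p :: "real \<times> real"
    define T where "T = {p. 0 \<le> fst p \<and> 0 \<le> snd p \<and> fst p + snd p \<le> 1 \<and> h p \<in> P \<inter> Q}"
    have h_cont: "continuous_on UNIV h"
      unfolding h_def by (rule continuous_on_affine_seq)
    have "closed T"
    proof -
      have "T = {p. 0 \<le> fst p} \<inter> {p. 0 \<le> snd p} \<inter> {p. fst p + snd p \<le> 1} \<inter> h -` (P \<inter> Q)"
        by (auto simp: T_def)
      moreover have "closed (h -` (P \<inter> Q))"
        by (rule closed_vimage) (use P Q h_cont in auto)
      ultimately show ?thesis
        by (auto intro!: closed_Int closed_Collect_le continuous_intros)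
    qed
    moreover have "T \<subseteq> cbox (0, 0) (1, 1)" by (auto simp: T_def)
    ultimately have "compact T"
      by (metis bounded_cbox bounded_subset compact_eq_bounded_closed)
    moreover have "(0, 0) \<in> T" using z by (simp add: T_def h_def)
    ultimately have "\<exists>p\<in>T. \<forall>q\<in>T. fst q + snd q \<le> fst p + snd p"
      by (intro continuous_attains_sup continuous_intros) auto
    then obtain p where p: "p \<in> T" "\<And>q. q \<in> T \<Longrightarrow> fst q + snd q \<le> fst p + snd p"
      by blast
    obtain a b where ab: "p = (a, b)" by (cases p)
    have p': "0 \<le> a" "0 \<le> b" "a + b \<le> 1" "h p \<in> P" "h p \<in> Q" using p(1) by (auto simp: T_def ab)
    have "a + b = 1"
    proof (rule ccontr)
      assume "a + b \<noteq> 1"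
      then have lt: "a + b < 1" using p' by simp
      have no: "\<not> (0 < s \<and> s \<le> 1 \<and> h q \<in> P \<inter> Q)"
        if q: "q = (a + s * (1 - a), b - s * b) \<or> q = (a - s * a, b + s * (1 - b))" for s q
      proof
        assume s: "0 < s \<and> s \<le> 1 \<and> h q \<in> P \<inter> Q"
        have "fst q + snd q = (a + b) + s * (1 - (a + b))" using q by (auto simp: algebra_simps)
        moreover have "0 < s * (1 - (a + b))" "s * (1 - (a + b)) \<le> 1 * (1 - (a + b))"
          using s lt by (auto intro!: mult_right_mono)
        moreover have "0 \<le> fst q" "0 \<le> snd q"
          using q s p' mult_left_le_one_le[of a s] mult_left_le_one_le[of b s] by auto
        ultimately show False using p(2)[of q] s by (auto simp: T_def ab)
      qed
      have seg_x: "h (a + s * (1 - a), b - s * b) = h p + s *\<^sub>R (x - h p)" for s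
        by (simp add: h_def ab algebra_simps)
      have seg_y: "h (a - s * a, b + s * (1 - b)) = h p + s *\<^sub>R (y - h p)" for s
        by (simp add: h_def ab algebra_simps)
      have in_seg: "u + s *\<^sub>R (v - u) \<in> C" if "convex C" "u \<in> C" "v \<in> C" "0 < s" "s \<le> 1"
        for C and u v :: "nat \<Rightarrow> real" and s
        using convexD_alt[OF that(1-3), of s] that by (simp add: algebra_simps)
      show False
      proof (cases "h p \<in> G")
        case False
        then obtain s where "0 < s" "s \<le> 1" "h p + s *\<^sub>R (x - h p) \<notin> G"
          using segment_leaves_closed[OF G(1)] by metis
        then have "h p + s *\<^sub>R (x - h p) \<in> P \<inter> Q"
          using in_seg[OF P(2) p'(4) x] G(2) by blast
        then show False using no seg_x \<open>0 < s\<close> \<open>s \<le> 1\<close> by metis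
      next
        case True
        then have "h p \<notin> H" using GH by blast
        then obtain s where "0 < s" "s \<le> 1" "h p + s *\<^sub>R (y - h p) \<notin> H"
          using segment_leaves_closed[OF H(1)] by metis
        then have "h p + s *\<^sub>R (y - h p) \<in> P \<inter> Q"
          using in_seg[OF Q(2) p'(5) y] H(2) by blast
        then show False using no seg_y \<open>0 < s\<close> \<open>s \<le> 1\<close> by metis
      qed
    qed
    then have "a = 1 - b" by simp
    then have "h p = (1 - b) *\<^sub>R x + b *\<^sub>R y"
      by (simp add: h_def ab scaleR_diff_left scaleR_diff_right)
    then show ?thesis using p' by (intro exI[of _ b]) auto
  qed
  have seg: "(1 - u) *\<^sub>R x + u *\<^sub>R y \<in> P \<union> Q"
    if x: "x \<in> P" and y: "y \<in> Q" and u: "0 \<le> u" "u \<le> 1" for x y u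
  proof -
    obtain b where b: "0 \<le> b" "b \<le> 1" and c: "(1 - b) *\<^sub>R x + b *\<^sub>R y \<in> P \<inter> Q"
      using main[OF x y] by blast
    define c where "c = (1 - b) *\<^sub>R x + b *\<^sub>R y"
    show ?thesis
    proof (cases "u \<le> b")
      case True
      have "(1 - u / b) *\<^sub>R x + (u / b) *\<^sub>R c \<in> P"
        by (rule convexD_alt[OF P(2)]) (use True u b x c in \<open>auto simp: c_def divide_le_eq_1\<close>)
      moreover have "(1 - u / b) *\<^sub>R x + (u / b) *\<^sub>R c = (1 - u) *\<^sub>R x + u *\<^sub>R y"
      proof (cases "b = 0")
        case True
        then show ?thesis using \<open>u \<le> b\<close> u by simp
      next
        case False
        then show ?thesis by (simp add: c_def algebra_simps)
      qed
      ultimately show ?thesis by simp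
    next
      case False
      define r where "r = (1 - u) / (1 - b)"
      have r: "0 \<le> r" "r \<le> 1" "r * (1 - b) = 1 - u" using False u b by (auto simp: r_def)
      have "(1 - r) *\<^sub>R y + r *\<^sub>R c \<in> Q"
        by (rule convexD_alt[OF Q(2)]) (use r y c in \<open>auto simp: c_def\<close>)
      moreover have "(1 - r) *\<^sub>R y + r *\<^sub>R c = (r * (1 - b)) *\<^sub>R x + (1 - r * (1 - b)) *\<^sub>R y"
        by (simp add: c_def algebra_simps)
      ultimately show ?thesis using r(3) by simp
    qed
  qed
  show ?thesis
    unfolding convex_alt
  proof (intro ballI allI impI)
    fix x y :: "nat \<Rightarrow> real" and u :: real
    assume xy: "x \<in> P \<union> Q" "y \<in> P \<union> Q" and u: "0 \<le> u \<and> u \<le> 1"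
    consider "x \<in> P" "y \<in> P" | "x \<in> Q" "y \<in> Q" | "x \<in> P" "y \<in> Q" | "x \<in> Q" "y \<in> P"
      using xy by blast
    then show "(1 - u) *\<^sub>R x + u *\<^sub>R y \<in> P \<union> Q"
    proof cases
      case 1
      then show ?thesis using convexD_alt[OF P(2)] u by blast
    next
      case 2
      then show ?thesis using convexD_alt[OF Q(2)] u by blast
    next
      case 3
      then show ?thesis using seg u by blast
    next
      case 4
      then show ?thesis using seg[of y x "1 - u"] u by (simp add: add.commute)
    qed
  qed
qed

section \<open>Combinatorics of the code\<close>

lemma code_of_pattern:
  assumes "p \<in> topspace (Euclidean_space m)"
  shows "{i \<in> S. p \<in> U i} \<in> code_of m S U"
  using assms by (auto simp: code_of_def)

lemma code_of_realized:
  assumes "\<sigma> \<in> code_of m S U"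
  obtains p where "p \<in> topspace (Euclidean_space m)" "\<And>i. i \<in> S \<Longrightarrow> p \<in> U i \<longleftrightarrow> i \<in> \<sigma>"
  using assms by (auto simp: code_of_def)

lemma base_2dd_mem [simp]:
  "Alpha i \<in> base_2dd d \<longleftrightarrow> i \<in> {1..d}" "Beta i \<in> base_2dd d \<longleftrightarrow> i \<in> {1..d}"
  "Gamma i \<in> base_2dd d \<longleftrightarrow> i \<in> {1..d}" "Delta i \<in> base_2dd d \<longleftrightarrow> i \<in> {1..d}"
  by (auto simp: base_2dd_def)

lemma code_2dd_intros:
  "{} \<in> code_2dd d"
  "i \<in> {1..d} \<Longrightarrow> {Beta i, Gamma i} \<in> code_2dd d"
  "i \<in> {1..d - 1} \<Longrightarrow> {Beta i, Beta (i + 1), Gamma i} \<in> code_2dd d"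
  "i \<in> {1..d - 1} \<Longrightarrow> {Beta i, Beta (i + 1)} \<in> code_2dd d"
  "i \<in> {1..d - 1} \<Longrightarrow> {Beta i, Beta (i + 1), Gamma (i + 1)} \<in> code_2dd d"
  "i \<in> {1..d} \<Longrightarrow> {Alpha i, Beta i, Gamma i, Delta i} \<in> code_2dd d"
  "i \<in> {1..d} \<Longrightarrow> {Alpha i, Delta i} \<in> code_2dd d"
  "Alpha ` {1..d} \<union> Delta ` {1..d} \<in> code_2dd d"
  "Delta ` {1..d} \<in> code_2dd d"
  unfolding code_2dd_def
  by (iprover intro: UnI1 UnI2 CollectI exI conjI refl insertI1)+

lemma code_2dd_cases:
  assumes "\<sigma> \<in> code_2dd d"
  obtains "\<sigma> = {}"
  | i where "i \<in> {1..d}" "\<sigma> = {Beta i, Gamma i}"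
  | i where "i \<in> {1..d - 1}" "\<sigma> = {Beta i, Beta (i + 1), Gamma i}"
  | i where "i \<in> {1..d - 1}" "\<sigma> = {Beta i, Beta (i + 1)}"
  | i where "i \<in> {1..d - 1}" "\<sigma> = {Beta i, Beta (i + 1), Gamma (i + 1)}"
  | i where "i \<in> {1..d}" "\<sigma> = {Alpha i, Beta i, Gamma i, Delta i}"
  | i where "i \<in> {1..d}" "\<sigma> = {Alpha i, Delta i}"
  | "\<sigma> = Alpha ` {1..d} \<union> Delta ` {1..d}"
  | "\<sigma> = Delta ` {1..d}"
  using assms unfolding code_2dd_def
  by (elim UnE CollectE exE conjE singletonE) (rule that; assumption)+

context
  fixes \<sigma> :: "symb set" and d :: nat
  assumes \<sigma>: "\<sigma> \<in> code_2dd d"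
begin

lemma two_Delta_imp_all: "Delta i \<in> \<sigma> \<Longrightarrow> Delta j \<in> \<sigma> \<Longrightarrow> i \<noteq> j \<Longrightarrow> k \<in> {1..d} \<Longrightarrow> Delta k \<in> \<sigma>"
  by (rule code_2dd_cases[OF \<sigma>]) auto

lemma Delta_not_Alpha_imp_all: "Delta i \<in> \<sigma> \<Longrightarrow> Alpha i \<notin> \<sigma> \<Longrightarrow> k \<in> {1..d} \<Longrightarrow> Delta k \<in> \<sigma>"
  by (rule code_2dd_cases[OF \<sigma>]) auto

lemma Beta_imp_one_Delta: "Beta i \<in> \<sigma> \<Longrightarrow> Delta j \<in> \<sigma> \<Longrightarrow> Delta k \<in> \<sigma> \<Longrightarrow> j = k"
  by (rule code_2dd_cases[OF \<sigma>]) auto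

lemma Beta_adjacent: "Beta i \<in> \<sigma> \<Longrightarrow> Beta j \<in> \<sigma> \<Longrightarrow> i \<le> j \<Longrightarrow> j \<le> i + 1"
  by (rule code_2dd_cases[OF \<sigma>]) auto

lemma Gamma_imp_Beta: "Gamma i \<in> \<sigma> \<Longrightarrow> Beta i \<in> \<sigma>"
  by (rule code_2dd_cases[OF \<sigma>]) auto

lemma Gamma_unique: "Gamma i \<in> \<sigma> \<Longrightarrow> Gamma j \<in> \<sigma> \<Longrightarrow> i = j"
  by (rule code_2dd_cases[OF \<sigma>]) auto

lemma Beta_covered:
  "Beta i \<in> \<sigma> \<Longrightarrow> Gamma i \<in> \<sigma> \<or> i < d \<and> Beta (i + 1) \<in> \<sigma> \<or> 1 < i \<and> Beta (i - 1) \<in> \<sigma>"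
  by (rule code_2dd_cases[OF \<sigma>]) auto

end

section \<open>Lower bound for closed realizations\<close>

lemma sum_fun_apply: "(\<Sum>i\<in>A. f i) x = (\<Sum>i\<in>A. f i x)"
  for f :: "'i \<Rightarrow> 'a \<Rightarrow> 'b::comm_monoid_add"
  by (induction A rule: infinite_finite_induct) auto

lemma Euclidean_space_subset_span:
  "topspace (Euclidean_space m) \<subseteq> span ((\<lambda>j i. if i = j then 1 else (0::real)) ` {..<m})"
proof
  fix x assume x: "x \<in> topspace (Euclidean_space m)"
  have "(\<Sum>j<m. x j *\<^sub>R (\<lambda>i. if i = j then 1 else (0::real))) = x"
  proof
    fix k
    have "(\<Sum>j<m. x j *\<^sub>R (\<lambda>i. if i = j then 1 else (0::real))) k = (\<Sum>j<m. if k = j then x j else 0)"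
      unfolding sum_fun_apply by (rule sum.cong) (auto simp: scaleR_fun_def)
    also have "\<dots> = x k" using x by (auto simp: topspace_Euclidean_space)
    finally show "(\<Sum>j<m. x j *\<^sub>R (\<lambda>i. if i = j then 1 else (0::real))) k = x k" .
  qed
  then show "x \<in> span ((\<lambda>j i. if i = j then 1 else (0::real)) ` {..<m})"
    by (metis (no_types, lifting) imageI span_base span_scale span_sum)
qed

lemma subspace_Euclidean_space: "subspace (topspace (Euclidean_space m))"
  by (auto simp: subspace_def topspace_Euclidean_space scaleR_fun_def)

context
  fixes d m :: nat and X :: "symb \<Rightarrow> (nat \<Rightarrow> real) set"
  assumes d: "2 \<le> d"
    and closed_family: "closed_convex_family m (base_2dd d) X"
    and code: "code_of m (base_2dd d) X = code_2dd d"
begin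

lemma realization_closed: "s \<in> base_2dd d \<Longrightarrow> closed (X s)"
  and realization_convex: "s \<in> base_2dd d \<Longrightarrow> convex (X s)"
  and realization_subset: "s \<in> base_2dd d \<Longrightarrow> X s \<subseteq> topspace (Euclidean_space m)"
  using closed_family
  by (auto simp: closed_convex_family_def closedin_Euclidean_space_iff seq_convex_iff_convex)

lemma pattern_codeword:
  "p \<in> topspace (Euclidean_space m) \<Longrightarrow> {s \<in> base_2dd d. p \<in> X s} \<in> code_2dd d"
  using code_of_pattern code by metis

lemma codeword_realized:
  assumes "\<sigma> \<in> code_2dd d"
  obtains p where "p \<in> topspace (Euclidean_space m)" "\<And>s. s \<in> base_2dd d \<Longrightarrow> p \<in> X s \<longleftrightarrow> s \<in> \<sigma>"
  using assms code_of_realized code by metis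

text \<open>
  By induction along the chain, \<open>closed_convex_Un\<close> is applied to \<open>B\<^sub>1 \<union> \<dots> \<union> B\<^sub>k\<close> and \<open>B\<^sub>k\<^sub>+\<^sub>1\<close>. Outside
  \<open>B\<^sub>k\<^sub>+\<^sub>1\<close>, the former is covered by \<open>B\<^sub>1, \<dots>, B\<^sub>k\<^sub>-\<^sub>1\<close> and \<open>G\<^sub>k\<close>, because no codeword has \<open>\<beta>\<^sub>k\<close> without
  \<open>\<gamma>\<^sub>k\<close> or a neighbour; likewise the latter is covered by \<open>G\<^sub>k\<^sub>+\<^sub>1\<close> and \<open>B\<^sub>k\<^sub>+\<^sub>2\<close>. No codeword
  combines an element of the first group with one of the second.
\<close>

lemma convex_Union_Beta:
  assumes "1 \<le> k" "k \<le> d"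
  shows "convex (\<Union>i\<in>{1..k}. X (Beta i))"
  using assms
proof (induction k rule: nat_induct_at_least)
  case base
  then show ?case using realization_convex[of "Beta 1"] d by simp
next
  case (Suc k)
  define L where "L = (\<Union>i\<in>{1..k}. X (Beta i))"
  have sub: "X s \<subseteq> topspace (Euclidean_space m)" if "s \<in> base_2dd d" for s
    using realization_subset[OF that] .
  have codeword: "{s \<in> base_2dd d. p \<in> X s} \<in> code_2dd d" if "p \<in> X s" "s \<in> base_2dd d" for p s
    using pattern_codeword sub that by blast
  define G where "G = (\<Union>i\<in>{1..<k}. X (Beta i)) \<union> X (Gamma k)"
  define H where "H = X (Gamma (k + 1)) \<union> (if k + 2 \<le> d then X (Beta (k + 2)) else {})"
  have "convex (L \<union> X (Beta (k + 1)))"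
  proof (rule closed_convex_Un)
    show "convex L" using Suc by (simp add: L_def)
    show "closed L" "closed G" "closed H"
      using Suc by (auto simp: L_def G_def H_def intro!: closed_Un closed_UN realization_closed)
    show "closed (X (Beta (k + 1)))" "convex (X (Beta (k + 1)))"
      using Suc by (auto intro!: realization_closed realization_convex)
    show "L - X (Beta (k + 1)) \<subseteq> G"
    proof
      fix p assume p: "p \<in> L - X (Beta (k + 1))"
      then obtain i where i: "i \<in> {1..k}" "p \<in> X (Beta i)" by (auto simp: L_def)
      show "p \<in> G"
      proof (cases "i = k")
        case False
        then show ?thesis using i by (auto simp: G_def)
      next
        case True
        have "p \<in> X (Gamma k) \<or> 1 < k \<and> p \<in> X (Beta (k - 1))"
          using Beta_covered[OF codeword[OF i(2)], of k] i True p Suc by auto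
        then show ?thesis by (auto simp: G_def)
      qed
    qed
    show "X (Beta (k + 1)) - L \<subseteq> H"
    proof
      fix p assume p: "p \<in> X (Beta (k + 1)) - L"
      then have "p \<notin> X (Beta k)" using Suc by (auto simp: L_def)
      then show "p \<in> H"
        using Beta_covered[OF codeword[of p "Beta (k + 1)"], of "k + 1"] p Suc
        by (auto simp: H_def)
    qed
    show "G \<inter> H = {}"
    proof (rule ccontr)
      assume "G \<inter> H \<noteq> {}"
      then obtain p where p: "p \<in> G" "p \<in> H" by blast
      have k: "1 \<le> k" "k + 1 \<le> d" using Suc by auto
      have "p \<in> X (Gamma (k + 1)) \<or> k + 2 \<le> d \<and> p \<in> X (Beta (k + 2))"
        using p(2) by (auto simp: H_def split: if_splits)
      then have cw: "{s \<in> base_2dd d. p \<in> X s} \<in> code_2dd d"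
        using codeword[of p "Gamma (k + 1)"] codeword[of p "Beta (k + 2)"] k by auto
      obtain j where j: "j \<in> {k + 1, k + 2}" "j \<le> d" "p \<in> X (Beta j)"
          "j = k + 1 \<Longrightarrow> p \<in> X (Gamma (k + 1))"
      proof (cases "p \<in> X (Gamma (k + 1))")
        case True
        then have "p \<in> X (Beta (k + 1))" using Gamma_imp_Beta[OF cw, of "k + 1"] k by simp
        then show thesis using that[of "k + 1"] True k by simp
      next
        case False
        then show thesis
          using that[of "k + 2"] \<open>p \<in> X (Gamma (k + 1)) \<or> k + 2 \<le> d \<and> p \<in> X (Beta (k + 2))\<close> by simp
      qed
      obtain i where i: "1 \<le> i" "i \<le> k" "p \<in> X (Beta i)" "i = k \<Longrightarrow> p \<in> X (Gamma k)"
      proof (cases "p \<in> X (Gamma k)")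
        case True
        then have "p \<in> X (Beta k)" using Gamma_imp_Beta[OF cw, of k] k by simp
        then show thesis using that[of k] True k by simp
      next
        case False
        then obtain i where "i \<in> {1..<k}" "p \<in> X (Beta i)" using p(1) by (auto simp: G_def)
        then show thesis using that[of i] by simp
      qed
      have "j \<le> i + 1" using Beta_adjacent[OF cw, of i j] i j k by auto
      then have "i = k" "j = k + 1" using i j by auto
      then show False using Gamma_unique[OF cw, of k "k + 1"] i j k by auto
    qed
    have "{Beta k, Beta (k + 1)} \<in> code_2dd d"
      using Suc.hyps Suc.prems by (intro code_2dd_intros) simp
    then obtain p where "\<And>s. s \<in> base_2dd d \<Longrightarrow> p \<in> X s \<longleftrightarrow> s \<in> {Beta k, Beta (k + 1)}"
      using codeword_realized by metis
    then have "p \<in> X (Beta k)" "p \<in> X (Beta (k + 1))" using Suc.hyps Suc.prems by simp_all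
    moreover have "X (Beta k) \<subseteq> L" unfolding L_def using Suc.hyps by (intro UN_upper) simp
    ultimately show "L \<inter> X (Beta (k + 1)) \<noteq> {}" by blast
  qed
  moreover have "L \<union> X (Beta (k + 1)) = (\<Union>i\<in>{1..Suc k}. X (Beta i))"
    by (auto simp: L_def atLeastAtMostSuc_conv)
  ultimately show ?case by simp
qed

text \<open>
  The sunflower lemma applies with a point \<open>f\<close> of codeword \<open>\<delta>\<^bsub>[d]\<^esub>\<close>: since \<open>f\<close> is not in the closed set
  \<open>X (Alpha i)\<close>, the segment from \<open>f\<close> to \<open>w i\<close> starts in \<open>X (Delta i) - X (Alpha i)\<close>, which is part of
  the center.
\<close>

lemma closed_realization_dim: "d \<le> m"
proof (rule ccontr)
  assume "\<not> d \<le> m"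
  define V where "V = topspace (Euclidean_space m)"
  define E where "E = (\<Inter>i\<in>{1..d}. X (Delta i))"
  have V: "subspace V" by (simp add: V_def subspace_Euclidean_space)
  have sub: "X s \<subseteq> V" if "s \<in> base_2dd d" for s
    using realization_subset[OF that] by (simp add: V_def)
  have codeword: "{s \<in> base_2dd d. p \<in> X s} \<in> code_2dd d" if "p \<in> V" for p
    using pattern_codeword that by (simp add: V_def)
  have "Delta ` {1..d} \<in> code_2dd d" by (rule code_2dd_intros)
  then obtain f where f: "f \<in> V" "\<And>s. s \<in> base_2dd d \<Longrightarrow> f \<in> X s \<longleftrightarrow> s \<in> Delta ` {1..d}"
    using codeword_realized unfolding V_def by metis
  have "\<exists>p. p \<in> X (Beta i) \<and> p \<in> X (Delta i)" if "i \<in> {1..d}" for i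
  proof -
    have "{Alpha i, Beta i, Gamma i, Delta i} \<in> code_2dd d" using that by (rule code_2dd_intros)
    then obtain p where "\<And>s. s \<in> base_2dd d \<Longrightarrow> p \<in> X s \<longleftrightarrow> s \<in> {Alpha i, Beta i, Gamma i, Delta i}"
      using codeword_realized by metis
    then have "p \<in> X (Beta i)" "p \<in> X (Delta i)" using that by simp_all
    then show ?thesis by blast
  qed
  then obtain w where w: "\<And>i. i \<in> {1..d} \<Longrightarrow> w i \<in> X (Beta i)" "\<And>i. i \<in> {1..d} \<Longrightarrow> w i \<in> X (Delta i)"
    by metis
  have wV: "w i \<in> V" if "i \<in> {1..d}" for i using w(1)[OF that] sub[of "Beta i"] that by auto
  obtain c where c: "\<exists>i\<in>{1..d}. c i \<noteq> 0" "(\<Sum>i\<in>{1..d}. c i *\<^sub>R (w i - f)) = 0"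
  proof (rule dependent_family_obtain)
    show "card ((\<lambda>j i. if i = j then 1 else (0::real)) ` {..<m}) < card {1..d}"
      using card_image_le[of "{..<m}" "\<lambda>j i. if i = j then 1 else (0::real)"] \<open>\<not> d \<le> m\<close> by simp
    have "(\<lambda>i. w i - f) ` {1..d} \<subseteq> V"
      using wV f V by (auto intro: subspace_diff)
    then show "(\<lambda>i. w i - f) ` {1..d} \<subseteq> span ((\<lambda>j i. if i = j then 1 else (0::real)) ` {..<m})"
      using Euclidean_space_subset_span V_def by blast
  qed auto
  have "convex hull (w ` {1..d}) \<inter> E \<noteq> {}"
  proof (rule dependent_petals_hull_meets_center[OF _ _ _ _ _ _ _ c])
    show "convex (X (Delta i))" if "i \<in> {1..d}" for i
      using that by (intro realization_convex) auto
    show "X (Delta i) \<inter> X (Delta j) = E" if "i \<in> {1..d}" "j \<in> {1..d}" "i \<noteq> j" for i j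
    proof
      show "E \<subseteq> X (Delta i) \<inter> X (Delta j)" using that by (auto simp: E_def)
      show "X (Delta i) \<inter> X (Delta j) \<subseteq> E"
      proof
        fix p assume p: "p \<in> X (Delta i) \<inter> X (Delta j)"
        then have "p \<in> V" using sub[of "Delta i"] that by auto
        show "p \<in> E"
          using two_Delta_imp_all[OF codeword[OF \<open>p \<in> V\<close>], of i j] p that by (simp add: E_def)
      qed
    qed
    show "f \<in> E" using f by (auto simp: E_def)
    show "w i \<in> X (Delta i)" if "i \<in> {1..d}" for i using w that by blast
    show "\<exists>t>0. f + t *\<^sub>R (w i - f) \<in> E" if i: "i \<in> {1..d}" for i
    proof -
      have "f \<notin> X (Alpha i)" using f(2)[of "Alpha i"] i by auto
      then obtain t where t: "0 < t" "t \<le> 1" "f + t *\<^sub>R (w i - f) \<notin> X (Alpha i)"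
        using segment_leaves_closed[of "X (Alpha i)" f "w i"] realization_closed[of "Alpha i"] i
        by (metis base_2dd_mem(1))
      have "(1 - t) *\<^sub>R f + t *\<^sub>R w i \<in> X (Delta i)"
        by (rule convexD_alt[OF realization_convex]) (use i t w f in auto)
      then have D: "f + t *\<^sub>R (w i - f) \<in> X (Delta i)"
        by (simp add: algebra_simps)
      then have "f + t *\<^sub>R (w i - f) \<in> V" using sub[of "Delta i"] i by auto
      from Delta_not_Alpha_imp_all[OF codeword[OF this], of i] D t i
      have "f + t *\<^sub>R (w i - f) \<in> E" by (auto simp: E_def)
      then show ?thesis using t by blast
    qed
    show "f + x \<in> E" if "\<And>s. 0 \<le> s \<Longrightarrow> s < 1 \<Longrightarrow> f + s *\<^sub>R x \<in> E" for x
    proof -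
      have "closed E" unfolding E_def by (auto intro!: realization_closed)
      then have "closed ((\<lambda>s. f + s *\<^sub>R x) -` E)"
        by (intro closed_vimage continuous_on_line_seq)
      moreover have "{0..<1} \<subseteq> (\<lambda>s. f + s *\<^sub>R x) -` E" using that by auto
      ultimately have "closure {0..<1} \<subseteq> (\<lambda>s. f + s *\<^sub>R x) -` E"
        by (rule closure_minimal[rotated])
      moreover have "1 \<in> closure {0..<1::real}" by simp
      ultimately have "1 \<in> (\<lambda>s. f + s *\<^sub>R x) -` E" by blast
      then show ?thesis by simp
    qed
  qed simp
  moreover have "convex hull (w ` {1..d}) \<subseteq> (\<Union>i\<in>{1..d}. X (Beta i))"
    by (rule hull_minimal) (use w convex_Union_Beta[of d] d in auto)
  ultimately obtain p i where p: "p \<in> E" "i \<in> {1..d}" "p \<in> X (Beta i)" by blast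
  then have "p \<in> V" using sub[of "Beta i"] by auto
  from Beta_imp_one_Delta[OF codeword[OF this], of i 1 2] p d show False
    by (auto simp: E_def)
qed

end

section \<open>Closures of open realizations\<close>

lemma Euclidean_space_eq_subtopology: "Euclidean_space m = top_of_set (topspace (Euclidean_space m))"
  by (simp only: topspace_Euclidean_space) (simp only: Euclidean_space_def euclidean_product_topology)

lemma closed_topspace_Euclidean_space: "closed (topspace (Euclidean_space m))"
  using closedin_Euclidean_space_iff[of m "topspace (Euclidean_space m)"] by simp

lemma Euclidean_space_closure_of:
  assumes "X \<subseteq> topspace (Euclidean_space m)"
  shows "Euclidean_space m closure_of X = closure X"
proof -
  have "Euclidean_space m closure_of X = topspace (Euclidean_space m) \<inter> closure X"
    using assms
    by (subst Euclidean_space_eq_subtopology) (simp add: closure_of_subtopology Int_absorb1)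
  then show ?thesis
    using closure_minimal[OF assms closed_topspace_Euclidean_space] by blast
qed

lemma convex_closure_seq:
  fixes X :: "(nat \<Rightarrow> real) set"
  assumes "convex X"
  shows "convex (closure X)"
  unfolding convex_def
proof (intro ballI allI impI)
  fix x y :: "nat \<Rightarrow> real" and u v :: real
  assume xy: "x \<in> closure X" "y \<in> closure X" and uv: "0 \<le> u" "0 \<le> v" "u + v = 1"
  define h where "h p = u *\<^sub>R fst p + v *\<^sub>R snd p" for p :: "(nat \<Rightarrow> real) \<times> (nat \<Rightarrow> real)"
  have "continuous_on (closure (X \<times> X)) h"
    unfolding h_def
  proof (rule continuous_on_coordinatewise_then_product)
    fix i
    have "continuous_on (closure (X \<times> X)) (\<lambda>p. u * fst p i + v * snd p i)"
      using continuous_on_product_then_coordinatewise[where f = fst]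
        continuous_on_product_then_coordinatewise[where f = snd]
      by (intro continuous_on_add continuous_on_mult_left) (simp_all add: continuous_on_fst continuous_on_snd)
    then show "continuous_on (closure (X \<times> X)) (\<lambda>p. (u *\<^sub>R fst p + v *\<^sub>R snd p) i)"
      by (simp add: scaleR_fun_def)
  qed
  moreover have "h ` (X \<times> X) \<subseteq> closure X"
  proof -
    have "h p \<in> X" if "p \<in> X \<times> X" for p
      unfolding h_def by (rule convexD[OF assms]) (use that uv in auto)
    then show ?thesis using closure_subset by blast
  qed
  ultimately have "h ` closure (X \<times> X) \<subseteq> closure X"
    by (rule image_closure_subset[OF _ closed_closure])
  moreover have "(x, y) \<in> closure (X \<times> X)" using xy by (simp add: closure_Times)
  ultimately have "h (x, y) \<in> closure X" by blast
  then show "u *\<^sub>R x + v *\<^sub>R y \<in> closure X" by (simp add: h_def)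
qed

lemma closed_convex_family_closure:
  assumes "open_convex_family m S U"
  shows "closed_convex_family m S (\<lambda>i. Euclidean_space m closure_of U i)"
  unfolding closed_convex_family_def seq_convex_iff_convex
proof (intro ballI conjI)
  fix i assume "i \<in> S"
  then have "U i \<subseteq> topspace (Euclidean_space m)" "convex (U i)"
    using assms by (auto simp: open_convex_family_def seq_convex_iff_convex dest: openin_subset)
  then show "convex (Euclidean_space m closure_of U i)"
    by (simp add: Euclidean_space_closure_of convex_closure_seq)
qed simp

section \<open>No realization on a line\<close>

lemma interval_mem:
  assumes "m \<le> 1" "convex X" "x \<in> X" "z \<in> X" "x 0 \<le> y 0" "y 0 \<le> z 0"
    and "x \<in> topspace (Euclidean_space m)" "y \<in> topspace (Euclidean_space m)" "z \<in> topspace (Euclidean_space m)"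
  shows "y \<in> X"
proof -
  have "y 0 \<in> closed_segment (x 0) (z 0)" using assms by (simp add: closed_segment_eq_real_ivl)
  then obtain u where u: "0 \<le> u" "u \<le> 1" "y 0 = (1 - u) * x 0 + u * z 0"
    by (auto simp: closed_segment_def)
  have "y i = (1 - u) * x i + u * z i" for i
    using u assms by (cases i) (auto simp: topspace_Euclidean_space)
  then have "y = (1 - u) *\<^sub>R x + u *\<^sub>R z" by (auto simp: scaleR_fun_def)
  then show ?thesis using convexD_alt[OF assms(2-4) u(1,2)] by simp
qed

text \<open>
  Four betweenness relations are excluded for the points \<open>a1\<close>, \<open>a2\<close>, \<open>f\<close> and \<open>g\<close> with codewords
  \<open>\<alpha>\<^sub>1\<delta>\<^sub>1\<close>, \<open>\<alpha>\<^sub>2\<delta>\<^sub>2\<close>, \<open>\<delta>\<^bsub>[d]\<^esub>\<close> and \<open>\<alpha>\<^bsub>[d]\<^esub>\<delta>\<^bsub>[d]\<^esub>\<close>; together they leave no linear order. In the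
  one-point space, all of these points coincide and the relations hold trivially.
\<close>

lemma convex_realization_dim_ge_2:
  assumes d: "2 \<le> d"
    and conv: "\<And>s. s \<in> base_2dd d \<Longrightarrow> convex (U s)"
    and code: "code_of m (base_2dd d) U = code_2dd d"
  shows "2 \<le> m"
proof (rule ccontr)
  assume "\<not> 2 \<le> m"
  then have m: "m \<le> 1" by simp
  define V where "V = topspace (Euclidean_space m)"
  have real: "\<exists>p\<in>V. \<forall>s\<in>base_2dd d. p \<in> U s \<longleftrightarrow> s \<in> \<sigma>" if "\<sigma> \<in> code_2dd d" for \<sigma>
    using that code_of_realized[of \<sigma> m "base_2dd d" U] code unfolding V_def by metis
  have one: "\<exists>p\<in>V. \<forall>s\<in>base_2dd d. p \<in> U s \<longleftrightarrow> s \<in> {Alpha i, Delta i}" if "i \<in> {1..d}" for i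
    by (rule real[OF code_2dd_intros(7)[OF that]])
  obtain a1 where a1: "a1 \<in> V" "\<And>s. s \<in> base_2dd d \<Longrightarrow> a1 \<in> U s \<longleftrightarrow> s \<in> {Alpha 1, Delta 1}"
    using one[of 1] d by auto
  obtain a2 where a2: "a2 \<in> V" "\<And>s. s \<in> base_2dd d \<Longrightarrow> a2 \<in> U s \<longleftrightarrow> s \<in> {Alpha 2, Delta 2}"
    using one[of 2] d by auto
  have "Delta ` {1..d} \<in> code_2dd d" "Alpha ` {1..d} \<union> Delta ` {1..d} \<in> code_2dd d"
    by (rule code_2dd_intros)+
  then obtain f g where
    f: "f \<in> V" "\<And>s. s \<in> base_2dd d \<Longrightarrow> f \<in> U s \<longleftrightarrow> s \<in> Delta ` {1..d}" and
    g: "g \<in> V" "\<And>s. s \<in> base_2dd d \<Longrightarrow> g \<in> U s \<longleftrightarrow> s \<in> Alpha ` {1..d} \<union> Delta ` {1..d}"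
    using real by metis
  have mem: "a1 \<in> U (Alpha 1)" "a1 \<in> U (Delta 1)" "a2 \<in> U (Alpha 2)" "a2 \<in> U (Delta 2)"
    "f \<in> U (Delta 1)" "f \<in> U (Delta 2)" "g \<in> U (Delta 1)" "g \<in> U (Delta 2)"
    "g \<in> U (Alpha 1)" "g \<in> U (Alpha 2)"
    "a1 \<notin> U (Delta 2)" "a2 \<notin> U (Delta 1)" "f \<notin> U (Alpha 1)" "f \<notin> U (Alpha 2)"
    using a1 a2 f g d by auto
  have between: "y \<in> U s"
    if "s \<in> {Alpha 1, Alpha 2, Delta 1, Delta 2}" "x \<in> U s" "z \<in> U s"
      "x 0 \<le> y 0 \<and> y 0 \<le> z 0 \<or> z 0 \<le> y 0 \<and> y 0 \<le> x 0" "x \<in> V" "y \<in> V" "z \<in> V" for s x y z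
  proof -
    have "convex (U s)" using conv that d by auto
    then show ?thesis using interval_mem[OF m] that unfolding V_def by blast
  qed
  have n1: "\<not> (a1 0 \<le> f 0 \<and> f 0 \<le> g 0)" "\<not> (g 0 \<le> f 0 \<and> f 0 \<le> a1 0)"
    using between[of "Alpha 1" a1 g f] mem a1 f g by blast+
  have n2: "\<not> (a2 0 \<le> f 0 \<and> f 0 \<le> g 0)" "\<not> (g 0 \<le> f 0 \<and> f 0 \<le> a2 0)"
    using between[of "Alpha 2" a2 g f] mem a2 f g by blast+
  have n3: "\<not> (f 0 \<le> a1 0 \<and> a1 0 \<le> a2 0)" "\<not> (a2 0 \<le> a1 0 \<and> a1 0 \<le> f 0)"
    using between[of "Delta 2" a2 f a1] mem a1 a2 f by blast+
  have n4: "\<not> (f 0 \<le> a2 0 \<and> a2 0 \<le> a1 0)" "\<not> (a1 0 \<le> a2 0 \<and> a2 0 \<le> f 0)"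
    using between[of "Delta 1" a1 f a2] mem a1 a2 f by blast+
  from n1 n2 n3 n4 show False by linarith
qed

section \<open>Recognizing codewords and families\<close>

text \<open>
  With these conditions, the codeword of an arbitrary point of a realization can be recognized from a
  few inequalities between its coordinates, without a classification of all regions.
\<close>

lemma codeword_2ddI:
  assumes d: "2 \<le> d" and sub: "\<sigma> \<subseteq> base_2dd d"
    and ad: "\<And>i. Alpha i \<in> \<sigma> \<Longrightarrow> Delta i \<in> \<sigma>"
    and dd: "\<And>i j k. Delta i \<in> \<sigma> \<Longrightarrow> Delta j \<in> \<sigma> \<Longrightarrow> i \<noteq> j \<Longrightarrow> k \<in> {1..d} \<Longrightarrow> Delta k \<in> \<sigma>"
    and ada: "\<And>i j. Alpha i \<in> \<sigma> \<Longrightarrow> Delta j \<in> \<sigma> \<Longrightarrow> Alpha j \<in> \<sigma>"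
    and da: "\<And>i j. Delta i \<in> \<sigma> \<Longrightarrow> Alpha i \<notin> \<sigma> \<Longrightarrow> j \<in> {1..d} \<Longrightarrow> Delta j \<in> \<sigma>"
    and bd: "\<And>i j. Beta i \<in> \<sigma> \<Longrightarrow> Delta j \<in> \<sigma> \<Longrightarrow> i = j"
    and gb: "\<And>i. Gamma i \<in> \<sigma> \<Longrightarrow> Beta i \<in> \<sigma>"
    and gg: "\<And>i j. Gamma i \<in> \<sigma> \<Longrightarrow> Gamma j \<in> \<sigma> \<Longrightarrow> i = j"
    and bb: "\<And>i j. Beta i \<in> \<sigma> \<Longrightarrow> Beta j \<in> \<sigma> \<Longrightarrow> j \<le> i + 1"
    and cover: "\<And>i. Beta i \<in> \<sigma> \<Longrightarrow>
      Gamma i \<in> \<sigma> \<or> i < d \<and> Beta (i + 1) \<in> \<sigma> \<or> 1 < i \<and> Beta (i - 1) \<in> \<sigma>"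
  shows "\<sigma> \<in> code_2dd d"
proof -
  have eqI: "\<sigma> = \<tau>"
    if "\<tau> \<subseteq> base_2dd d"
      "\<And>i. i \<in> {1..d} \<Longrightarrow> Alpha i \<in> \<sigma> \<longleftrightarrow> Alpha i \<in> \<tau>" "\<And>i. i \<in> {1..d} \<Longrightarrow> Beta i \<in> \<sigma> \<longleftrightarrow> Beta i \<in> \<tau>"
      "\<And>i. i \<in> {1..d} \<Longrightarrow> Gamma i \<in> \<sigma> \<longleftrightarrow> Gamma i \<in> \<tau>" "\<And>i. i \<in> {1..d} \<Longrightarrow> Delta i \<in> \<sigma> \<longleftrightarrow> Delta i \<in> \<tau>"
    for \<tau>
  proof -
    have "s \<in> \<sigma> \<longleftrightarrow> s \<in> \<tau>" if "s \<in> base_2dd d" for s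
      using that \<open>\<And>i. i \<in> {1..d} \<Longrightarrow> Alpha i \<in> \<sigma> \<longleftrightarrow> Alpha i \<in> \<tau>\<close>
        \<open>\<And>i. i \<in> {1..d} \<Longrightarrow> Beta i \<in> \<sigma> \<longleftrightarrow> Beta i \<in> \<tau>\<close>
        \<open>\<And>i. i \<in> {1..d} \<Longrightarrow> Gamma i \<in> \<sigma> \<longleftrightarrow> Gamma i \<in> \<tau>\<close>
        \<open>\<And>i. i \<in> {1..d} \<Longrightarrow> Delta i \<in> \<sigma> \<longleftrightarrow> Delta i \<in> \<tau>\<close> by (cases s) auto
    then show ?thesis using sub \<open>\<tau> \<subseteq> base_2dd d\<close> by blast
  qed
  have range: "Alpha i \<in> \<sigma> \<Longrightarrow> i \<in> {1..d}" "Beta i \<in> \<sigma> \<Longrightarrow> i \<in> {1..d}"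
    "Gamma i \<in> \<sigma> \<Longrightarrow> i \<in> {1..d}" "Delta i \<in> \<sigma> \<Longrightarrow> i \<in> {1..d}" for i
    using sub base_2dd_mem by blast+
  consider (pair) i where "Beta i \<in> \<sigma>" "Beta (i + 1) \<in> \<sigma>"
    | (single) i where "Beta i \<in> \<sigma>" "\<And>j. Beta j \<in> \<sigma> \<Longrightarrow> j = i"
    | (none) "\<And>i. Beta i \<notin> \<sigma>"
  proof (cases "\<exists>i. Beta i \<in> \<sigma>")
    case True
    then obtain i where i: "Beta i \<in> \<sigma>" by blast
    show thesis
    proof (cases "\<exists>j. Beta j \<in> \<sigma> \<and> j \<noteq> i")
      case True
      then obtain j where "Beta j \<in> \<sigma>" "j \<noteq> i" by blast
      then have "j = i + 1 \<or> i = j + 1" using bb[of i j] bb[of j i] i by auto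
      then show thesis using i \<open>Beta j \<in> \<sigma>\<close> pair by auto
    next
      case False
      then show thesis using i single by blast
    qed
  next
    case False
    then show thesis using none by blast
  qed
  then show ?thesis
  proof cases
    case (pair i)
    have i: "i \<in> {1..d - 1}" using range(2)[OF pair(1)] range(2)[OF pair(2)] by auto
    have beta: "Beta j \<in> \<sigma> \<longleftrightarrow> j = i \<or> j = i + 1" for j
      using pair bb[of i j] bb[of j "i + 1"] bb[of "i + 1" j] bb[of j i] by (auto simp: le_Suc_eq)
    have delta: "Delta j \<notin> \<sigma>" for j
      using bd[of i j] bd[of "i + 1" j] pair by auto
    have alpha: "Alpha j \<notin> \<sigma>" for j using ad[of j] delta by auto
    have gamma: "Gamma j \<in> \<sigma> \<Longrightarrow> j = i \<or> j = i + 1" for j using gb[of j] beta by auto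
    consider "Gamma i \<in> \<sigma>" "Gamma (i + 1) \<notin> \<sigma>" | "Gamma (i + 1) \<in> \<sigma>" "Gamma i \<notin> \<sigma>"
      | "Gamma i \<notin> \<sigma>" "Gamma (i + 1) \<notin> \<sigma>"
      using gg[of i "i + 1"] by auto
    then show ?thesis
    proof cases
      case 1
      then have gamma': "Gamma j \<in> \<sigma> \<longleftrightarrow> j = i" for j using gamma[of j] by auto
      have "\<sigma> = {Beta i, Beta (i + 1), Gamma i}"
        by (intro eqI) (use i in \<open>auto simp: alpha beta gamma' delta\<close>)
      then show ?thesis by (simp only: code_2dd_intros i)
    next
      case 2
      then have gamma': "Gamma j \<in> \<sigma> \<longleftrightarrow> j = i + 1" for j using gamma[of j] by auto
      have "\<sigma> = {Beta i, Beta (i + 1), Gamma (i + 1)}"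
        by (intro eqI) (use i in \<open>auto simp: alpha beta gamma' delta\<close>)
      then show ?thesis by (simp only: code_2dd_intros i)
    next
      case 3
      then have gamma': "Gamma j \<notin> \<sigma>" for j using gamma[of j] by auto
      have "\<sigma> = {Beta i, Beta (i + 1)}"
        by (intro eqI) (use i in \<open>auto simp: alpha beta gamma' delta\<close>)
      then show ?thesis by (simp only: code_2dd_intros i)
    qed
  next
    case (single i)
    have i: "i \<in> {1..d}" using range(2) single(1) .
    have beta: "Beta j \<in> \<sigma> \<longleftrightarrow> j = i" for j using single(1) single(2)[of j] by blast
    have Gi: "Gamma i \<in> \<sigma>"
      using cover[OF single(1)] beta[of "i + 1"] beta[of "i - 1"] by auto
    have gamma: "Gamma j \<in> \<sigma> \<longleftrightarrow> j = i" for j using gg[of j i] Gi by blast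
    show ?thesis
    proof (cases "Delta i \<in> \<sigma>")
      case True
      have delta: "Delta j \<in> \<sigma> \<longleftrightarrow> j = i" for j using bd[OF single(1), of j] True by auto
      have "Alpha i \<in> \<sigma>"
      proof (rule ccontr)
        assume "Alpha i \<notin> \<sigma>"
        then have "Delta 1 \<in> \<sigma>" "Delta 2 \<in> \<sigma>" using da[OF True] d by auto
        then show False using delta[of 1] delta[of 2] by simp
      qed
      then have alpha: "Alpha j \<in> \<sigma> \<longleftrightarrow> j = i" for j using ad[of j] delta by auto
      have "\<sigma> = {Alpha i, Beta i, Gamma i, Delta i}"
        by (intro eqI) (use i in \<open>auto simp: alpha beta gamma delta\<close>)
      then show ?thesis by (simp only: code_2dd_intros i)
    next
      case False
      then have delta: "Delta j \<notin> \<sigma>" for j using bd[OF single(1), of j] by auto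
      then have alpha: "Alpha j \<notin> \<sigma>" for j using ad[of j] by auto
      have "\<sigma> = {Beta i, Gamma i}"
        by (intro eqI) (use i in \<open>auto simp: alpha beta gamma delta\<close>)
      then show ?thesis by (simp only: code_2dd_intros i)
    qed
  next
    case none
    then have gamma: "Gamma i \<notin> \<sigma>" for i using gb[of i] by blast
    show ?thesis
    proof (cases "\<exists>i. Delta i \<in> \<sigma>")
      case False
      then have alpha: "Alpha j \<notin> \<sigma>" for j using ad[of j] by auto
      have "\<sigma> = {}" by (intro eqI) (use False in \<open>auto simp: none gamma alpha\<close>)
      then show ?thesis by (simp only: code_2dd_intros)
    next
      case True
      then obtain i where i: "Delta i \<in> \<sigma>" by blast
      show ?thesis
      proof (cases "\<exists>j. Delta j \<in> \<sigma> \<and> j \<noteq> i")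
        case True
        then have all: "Delta k \<in> \<sigma> \<longleftrightarrow> k \<in> {1..d}" for k using dd[OF i, of _ k] range(4)[of k] by blast
        show ?thesis
        proof (cases "\<exists>j. Alpha j \<in> \<sigma>")
          case True
          then have alpha: "Alpha k \<in> \<sigma> \<longleftrightarrow> k \<in> {1..d}" for k using ada[of _ k] all[of k] range(1)[of k] by blast
          have "\<sigma> = Alpha ` {1..d} \<union> Delta ` {1..d}"
            by (intro eqI) (auto simp: none gamma alpha all)
          then show ?thesis by (simp only: code_2dd_intros)
        next
          case False
          then have "\<sigma> = Delta ` {1..d}"
            by (intro eqI) (auto simp: none gamma all)
          then show ?thesis by (simp only: code_2dd_intros)
        qed
      next
        case False
        then have delta: "Delta j \<in> \<sigma> \<longleftrightarrow> j = i" for j using i by blast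
        have "Alpha i \<in> \<sigma>"
        proof (rule ccontr)
          assume "Alpha i \<notin> \<sigma>"
          then have "Delta 1 \<in> \<sigma>" "Delta 2 \<in> \<sigma>" using da[OF i] d by auto
          then show False using delta[of 1] delta[of 2] by simp
        qed
        then have alpha: "Alpha j \<in> \<sigma> \<longleftrightarrow> j = i" for j using ad[of j] delta by auto
        have "\<sigma> = {Alpha i, Delta i}"
          by (intro eqI) (use range(4)[OF i] in \<open>auto simp: none gamma alpha delta\<close>)
        then show ?thesis by (simp only: code_2dd_intros range(4)[OF i])
      qed
    qed
  qed
qed

lemma linear_coordinate: "linear (\<lambda>p. p i :: real)"
  by (rule linearI) (auto simp: scaleR_fun_def)

lemma convex_linear_Collect:
  fixes \<phi> :: "'v::real_vector \<Rightarrow> real"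
  assumes "linear \<phi>"
  shows "convex {p. \<phi> p < c}" "convex {p. c < \<phi> p}" "convex {p. \<phi> p \<le> c}" "convex {p. c \<le> \<phi> p}"
  using convex_linear_vimage[OF assms, of "{..<c}"] convex_linear_vimage[OF assms, of "{c<..}"]
    convex_linear_vimage[OF assms, of "{..c}"] convex_linear_vimage[OF assms, of "{c..}"]
  by (simp_all add: vimage_def)

lemma openin_Euclidean_space_Int:
  "open X \<Longrightarrow> openin (Euclidean_space m) (topspace (Euclidean_space m) \<inter> X)"
  by (subst Euclidean_space_eq_subtopology) (simp add: openin_open_Int)

lemma convex_topspace_Euclidean_space: "convex (topspace (Euclidean_space m))"
  by (simp add: subspace_Euclidean_space subspace_imp_convex)

lemma code_of_Int_topspace: "code_of m S (\<lambda>s. topspace (Euclidean_space m) \<inter> U s) = code_of m S U"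
  by (auto simp: code_of_def)

lemma code_of_eqI:
  assumes "C \<subseteq> Pow S"
    and "\<And>p. p \<in> topspace (Euclidean_space m) \<Longrightarrow> {s \<in> S. p \<in> U s} \<in> C"
    and "\<And>\<sigma>. \<sigma> \<in> C \<Longrightarrow> \<exists>p\<in>topspace (Euclidean_space m). \<forall>s\<in>S. p \<in> U s \<longleftrightarrow> s \<in> \<sigma>"
  shows "code_of m S U = C"
proof
  show "code_of m S U \<subseteq> C"
  proof
    fix \<sigma> assume "\<sigma> \<in> code_of m S U"
    then obtain p where p: "\<sigma> \<subseteq> S" "p \<in> topspace (Euclidean_space m)" "\<forall>i\<in>S. p \<in> U i \<longleftrightarrow> i \<in> \<sigma>"
      by (auto simp: code_of_def)
    then have "{s \<in> S. p \<in> U s} = \<sigma>" by blast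
    then show "\<sigma> \<in> C" using assms(2)[OF p(2)] by simp
  qed
  show "C \<subseteq> code_of m S U" using assms(1,3) by (auto simp: code_of_def)
qed

section \<open>An open realization in the plane\<close>

text \<open>
  The line \<open>y + 2 j x = j\<^sup>2\<close> is the tangent of \<open>y = - x\<^sup>2\<close> at \<open>x = j\<close>. The additional tangents at \<open>0\<close> and
  \<open>d + 1\<close> confine the petals of \<open>D\<^sub>1\<close> and \<open>D\<^sub>d\<close>, so that every petal lies in the half-plane \<open>x > 1 / 2\<close>
  that cuts \<open>A\<^sub>i\<close> out of \<open>D\<^sub>i\<close>. The bounds \<open>1 / 2 < x < d + 1 / 2\<close> on \<open>B\<^sub>i\<close> ensure that at
  the two ends of the chain there is no point with \<open>\<beta>\<^sub>i\<close> alone.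
\<close>

fun plane_set :: "nat \<Rightarrow> symb \<Rightarrow> (nat \<Rightarrow> real) set" where
  "plane_set d (Alpha i) = {p. \<forall>j\<in>{0..d + 1} - {i}. p 1 + 2 * real j * p 0 < (real j)\<^sup>2} \<inter> {p. 1 / 2 < p 0}"
| "plane_set d (Beta i) = {p. (real i)\<^sup>2 < p 1 + 2 * real i * p 0} \<inter>
    {p. real i - 3 / 4 < p 0} \<inter> {p. p 0 < real i + 3 / 4} \<inter> {p. 1 / 2 < p 0} \<inter> {p. p 0 < real d + 1 / 2}"
| "plane_set d (Gamma i) = {p. (real i)\<^sup>2 < p 1 + 2 * real i * p 0} \<inter>
    {p. real i - 1 / 2 < p 0} \<inter> {p. p 0 < real i + 1 / 2}"
| "plane_set d (Delta i) = {p. \<forall>j\<in>{0..d + 1} - {i}. p 1 + 2 * real j * p 0 < (real j)\<^sup>2}"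

declare plane_set.simps [simp del]

lemma open_plane_set: "open (plane_set d s)"
  by (cases s)
     (auto simp: plane_set.simps Collect_ball_eq
      intro!: open_Int open_INT open_Collect_less continuous_intros continuous_on_product_coordinates)

lemma convex_plane_set: "convex (plane_set d s)"
proof -
  have lin: "linear (\<lambda>p :: nat \<Rightarrow> real. p 1 + a * p 0)" for a
    by (rule linearI) (auto simp: scaleR_fun_def algebra_simps)
  note half = convex_linear_Collect[OF lin] convex_linear_Collect[OF linear_coordinate]
  show ?thesis
    by (cases s; simp only: plane_set.simps Collect_ball_eq; intro convex_Int convex_INT half)
qed

text \<open>
  In the coordinates \<open>x\<close> and \<open>u = y + x\<^sup>2\<close> the tangent at \<open>j\<close> becomes the parabola \<open>u = (x - j)\<^sup>2\<close>, and its
  position relative to another tangent depends only on which of the two indices is closer to \<open>x\<close>.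
\<close>

lemma below_tangent_iff:
  fixes x y j :: real
  shows "y + 2 * j * x < j\<^sup>2 \<longleftrightarrow> y + x\<^sup>2 < (x - j)\<^sup>2" "j\<^sup>2 < y + 2 * j * x \<longleftrightarrow> (x - j)\<^sup>2 < y + x\<^sup>2"
  by (auto simp: power2_eq_square algebra_simps)

lemma plane_set_iff:
  fixes p :: "nat \<Rightarrow> real"
  defines "x \<equiv> p 0" and "u \<equiv> p 1 + (p 0)\<^sup>2"
  shows "p \<in> plane_set d (Alpha i) \<longleftrightarrow> (\<forall>j\<in>{0..d + 1} - {i}. u < (x - real j)\<^sup>2) \<and> 1 / 2 < x"
    "p \<in> plane_set d (Beta i) \<longleftrightarrow>
      (x - real i)\<^sup>2 < u \<and> \<bar>x - real i\<bar> < 3 / 4 \<and> 1 / 2 < x \<and> x < real d + 1 / 2"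
    "p \<in> plane_set d (Gamma i) \<longleftrightarrow> (x - real i)\<^sup>2 < u \<and> \<bar>x - real i\<bar> < 1 / 2"
    "p \<in> plane_set d (Delta i) \<longleftrightarrow> (\<forall>j\<in>{0..d + 1} - {i}. u < (x - real j)\<^sup>2)"
  unfolding x_def u_def below_tangent_iff[symmetric] plane_set.simps abs_less_iff by auto

lemma plane_pattern:
  assumes d: "2 \<le> d"
  shows "{s \<in> base_2dd d. p \<in> plane_set d s} \<in> code_2dd d"
proof -
  define x where "x = p 0"
  define u where "u = p 1 + (p 0)\<^sup>2"
  note mem = plane_set_iff[of p, folded x_def u_def]
  show ?thesis
  proof (rule codeword_2ddI[OF d], goal_cases)
    case (3 i j k)
    then have "u < (x - real l)\<^sup>2" if "l \<in> {0..d + 1}" for l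
      using that by (cases "l = i") (auto simp: mem)
    then show ?case using 3 by (simp add: mem)
  next
    case (5 i j)
    then have x: "x \<le> 1 / 2" and i: "1 \<le> i" and u: "\<forall>l\<in>{0..d + 1} - {i}. u < (x - real l)\<^sup>2"
      by (simp_all add: mem)
    have "u < x\<^sup>2" using u[rule_format, of 0] i by simp
    moreover have "0 \<le> real i * (real i - 2 * x)" using x i by (intro mult_nonneg_nonneg) auto
    ultimately have "u < (x - real i)\<^sup>2" by (simp add: power2_eq_square algebra_simps)
    then have "u < (x - real l)\<^sup>2" if "l \<in> {0..d + 1}" for l
      using that u by (cases "l = i") auto
    then show ?case using 5 by (simp add: mem)
  next
    case (6 i j)
    show ?case
    proof (rule ccontr)
      assume "i \<noteq> j"
      then have "u < (x - real i)\<^sup>2" using 6 by (simp add: mem)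
      then show False using 6 by (simp add: mem)
    qed
  next
    case (10 i)
    then have b: "(x - real i)\<^sup>2 < u" "\<bar>x - real i\<bar> < 3 / 4" "1 / 2 < x" "x < real d + 1 / 2" and i: "1 \<le> i" "i \<le> d"
      by (simp_all add: mem)
    consider "\<bar>x - real i\<bar> < 1 / 2" | "1 / 2 \<le> x - real i" | "1 / 2 \<le> real i - x" by linarith
    then show ?case
    proof cases
      case 1
      then show ?thesis using b i by (simp add: mem)
    next
      case 2
      then have "i < d" using b by linarith
      moreover have "(x - real (i + 1))\<^sup>2 \<le> (x - real i)\<^sup>2"
        using 2 by (simp add: power2_eq_square algebra_simps)
      moreover have "\<bar>x - real (i + 1)\<bar> < 3 / 4" using 2 b by simp
      ultimately show ?thesis using b i by (simp add: mem)
    next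
      case 3
      then have "1 < i" using b by linarith
      moreover from this have "(x - real (i - 1))\<^sup>2 \<le> (x - real i)\<^sup>2"
        using 3 by (simp add: of_nat_diff power2_eq_square algebra_simps)
      moreover have "\<bar>x - real (i - 1)\<bar> < 3 / 4" using 3 b \<open>1 < i\<close> by (simp add: of_nat_diff)
      moreover have "i - 1 \<in> {1..d}" using \<open>1 < i\<close> i by auto
      moreover have "(x - real (i - 1))\<^sup>2 < u" using calculation b by linarith
      ultimately have "Beta (i - 1) \<in> {s \<in> base_2dd d. p \<in> plane_set d s}"
        using b by (simp only: mem mem_Collect_eq base_2dd_mem simp_thms)
      then show ?thesis using \<open>1 < i\<close> by blast
    qed
  next
    case (7 i)
    then have near: "\<bar>x - real i\<bar> < 1 / 2" and "1 \<le> real i" "real i \<le> real d" by (simp_all add: mem)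
    then have "1 / 2 < x" "x < real d + 1 / 2" "\<bar>x - real i\<bar> < 3 / 4" by linarith+
    then show ?case using 7 by (simp add: mem)
  next
    case (8 i j)
    then have "\<bar>x - real i\<bar> < 1 / 2" "\<bar>x - real j\<bar> < 1 / 2" by (simp_all add: mem)
    then show ?case by linarith
  next
    case (9 i j)
    then have "\<bar>x - real i\<bar> < 3 / 4" "\<bar>x - real j\<bar> < 3 / 4" by (simp_all add: mem)
    then show ?case by linarith
  qed (simp_all add: mem)
qed

lemma plane_realizedI:
  fixes x u :: real
  assumes "\<And>i. i \<in> {1..d} \<Longrightarrow> (\<forall>j\<in>{0..d + 1} - {i}. u < (x - real j)\<^sup>2) \<longleftrightarrow> Delta i \<in> \<sigma>"
    and "\<And>i. i \<in> {1..d} \<Longrightarrow> Delta i \<in> \<sigma> \<and> 1 / 2 < x \<longleftrightarrow> Alpha i \<in> \<sigma>"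
    and "\<And>i. i \<in> {1..d} \<Longrightarrow>
      (x - real i)\<^sup>2 < u \<and> \<bar>x - real i\<bar> < 3 / 4 \<and> 1 / 2 < x \<and> x < real d + 1 / 2 \<longleftrightarrow> Beta i \<in> \<sigma>"
    and "\<And>i. i \<in> {1..d} \<Longrightarrow> (x - real i)\<^sup>2 < u \<and> \<bar>x - real i\<bar> < 1 / 2 \<longleftrightarrow> Gamma i \<in> \<sigma>"
  shows "\<exists>p\<in>topspace (Euclidean_space 2). \<forall>s\<in>base_2dd d. p \<in> plane_set d s \<longleftrightarrow> s \<in> \<sigma>"
proof
  define p where "p k = (if k = 0 then x else if k = 1 then u - x\<^sup>2 else 0)" for k :: nat
  show "p \<in> topspace (Euclidean_space 2)"
    by (simp add: topspace_Euclidean_space p_def)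
  have "p 0 = x" "p 1 + x\<^sup>2 = u" by (simp_all add: p_def)
  note mem = plane_set_iff[of p, unfolded this]
  show "\<forall>s\<in>base_2dd d. p \<in> plane_set d s \<longleftrightarrow> s \<in> \<sigma>"
  proof
    fix s assume "s \<in> base_2dd d"
    then show "p \<in> plane_set d s \<longleftrightarrow> s \<in> \<sigma>"
      by (cases s) (simp_all only: mem base_2dd_mem assms)
  qed
qed

lemma dist_nat_less_iff:
  fixes c e :: real and i k :: nat
  assumes "0 \<le> c" "c \<le> 1" "e \<le> 1"
  shows "\<bar>real i + c - real k\<bar> < e \<longleftrightarrow> k = i \<and> c < e \<or> k = i + 1 \<and> 1 - c < e"
proof -
  consider "k < i" | "k = i" | "k = i + 1" | "i + 1 < k" by linarith
  then show ?thesis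
  proof cases
    case 1
    then have "real k + 1 \<le> real i" by linarith
    then show ?thesis using 1 assms by auto
  next
    case 4
    then have "real i + 2 \<le> real k" by linarith
    then show ?thesis using 4 assms by auto
  qed (use assms in auto)
qed

lemma plane_realized:
  assumes d: "2 \<le> d" and \<sigma>: "\<sigma> \<in> code_2dd d"
  shows "\<exists>p\<in>topspace (Euclidean_space 2). \<forall>s\<in>base_2dd d. p \<in> plane_set d s \<longleftrightarrow> s \<in> \<sigma>"
proof -
  have far: "1 \<le> (real i - real j)\<^sup>2" if "i \<noteq> j" for i j :: nat
  proof -
    have "1 \<le> \<bar>real i - real j\<bar>" using that by linarith
    then show ?thesis by (metis abs_1 abs_le_square_iff power_one)
  qed
  have no_delta: "(\<forall>j\<in>{0..d + 1} - {k}. 2 < (x - real j)\<^sup>2) \<longleftrightarrow> False"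
    if "real i \<le> x" "x \<le> real i + 1" "i \<le> d" for i k x
  proof -
    have "(x - real i)\<^sup>2 \<le> 1" "(x - real (i + 1))\<^sup>2 \<le> 1"
      using that by (auto simp: abs_square_le_1)
    moreover have "i \<in> {0..d + 1} - {k} \<or> i + 1 \<in> {0..d + 1} - {k}" using that by auto
    ultimately show ?thesis
      by (meson dual_order.strict_trans2 not_le one_le_numeral order.trans)
  qed
  have one_delta: "(\<forall>j\<in>{0..d + 1} - {k}. u < (real i - real j)\<^sup>2) \<longleftrightarrow> k = i"
    if "0 \<le> u" "u < 1" "i \<le> d" for i k u
  proof
    assume *: "\<forall>j\<in>{0..d + 1} - {k}. u < (real i - real j)\<^sup>2"
    show "k = i"
    proof (rule ccontr)
      assume "k \<noteq> i"
      then have "u < (real i - real i)\<^sup>2" using *[rule_format, of i] that by simp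
      then show False using that by simp
    qed
  next
    assume "k = i"
    then show "\<forall>j\<in>{0..d + 1} - {k}. u < (real i - real j)\<^sup>2"
      using far[of i] that by (metis Diff_iff insertI1 order.strict_trans2)
  qed
  have sq_lt_2: "(x - real i)\<^sup>2 < 2" if "\<bar>x - real i\<bar> < 1" for x i
  proof -
    have "(x - real i)\<^sup>2 \<le> 1" using that by (simp add: abs_square_le_1)
    then show ?thesis by simp
  qed
  (* The height u = 2 is above the parabolas of the nearest indices and above every petal. *)
  have chainI: ?thesis
    if x: "0 \<le> c" "c \<le> 1" "1 / 2 < real i + c" "real i + c < real d + 1 / 2" and i: "i \<le> d"
      and no: "\<And>k. Delta k \<notin> \<sigma>" "\<And>k. Alpha k \<notin> \<sigma>"
      and near: "\<And>k. k = i \<and> c < 3 / 4 \<or> k = i + 1 \<and> 1 - c < 3 / 4 \<longleftrightarrow> Beta k \<in> \<sigma>"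
        "\<And>k. k = i \<and> c < 1 / 2 \<or> k = i + 1 \<and> 1 - c < 1 / 2 \<longleftrightarrow> Gamma k \<in> \<sigma>"
    for i :: nat and c :: real
  proof (rule plane_realizedI[of d 2 "real i + c"])
    fix k
    show "(\<forall>j\<in>{0..d + 1} - {k}. 2 < (real i + c - real j)\<^sup>2) \<longleftrightarrow> Delta k \<in> \<sigma>"
      using no_delta[of i "real i + c" k] x i no(1)[of k] by simp
    show "Delta k \<in> \<sigma> \<and> 1 / 2 < real i + c \<longleftrightarrow> Alpha k \<in> \<sigma>" by (simp add: no)
    show "(real i + c - real k)\<^sup>2 < 2 \<and> \<bar>real i + c - real k\<bar> < 3 / 4 \<and> 1 / 2 < real i + c \<and>
        real i + c < real d + 1 / 2 \<longleftrightarrow> Beta k \<in> \<sigma>"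
      unfolding near(1)[symmetric] using x dist_nat_less_iff[of c "3 / 4" i k] sq_lt_2[of "real i + c" k] by linarith
    show "(real i + c - real k)\<^sup>2 < 2 \<and> \<bar>real i + c - real k\<bar> < 1 / 2 \<longleftrightarrow> Gamma k \<in> \<sigma>"
      unfolding near(2)[symmetric] using x dist_nat_less_iff[of c "1 / 2" i k] sq_lt_2[of "real i + c" k] by linarith
  qed
  (* At x = i, the petal of D i ranges over 0 <= u < 1; its part u > 0 is inside B i and G i. *)
  have petalI: ?thesis
    if u: "0 \<le> u" "u < 1" and i: "i \<in> {1..d}"
      and \<sigma>: "\<And>k. Delta k \<in> \<sigma> \<longleftrightarrow> k = i" "\<And>k. Alpha k \<in> \<sigma> \<longleftrightarrow> k = i"
        "\<And>k. Beta k \<in> \<sigma> \<longleftrightarrow> k = i \<and> 0 < u" "\<And>k. Gamma k \<in> \<sigma> \<longleftrightarrow> k = i \<and> 0 < u"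
    for u :: real and i :: nat
  proof (rule plane_realizedI[of d u "real i"])
    fix k
    have small: "(real i - real k)\<^sup>2 < u \<longleftrightarrow> k = i \<and> 0 < u"
      using far[of i k] u by (cases "k = i") auto
    show "(\<forall>j\<in>{0..d + 1} - {k}. u < (real i - real j)\<^sup>2) \<longleftrightarrow> Delta k \<in> \<sigma>"
      using one_delta[of u i k] u i \<sigma>(1)[of k] by simp
    show "Delta k \<in> \<sigma> \<and> 1 / 2 < real i \<longleftrightarrow> Alpha k \<in> \<sigma>" using i by (simp add: \<sigma>)
    show "(real i - real k)\<^sup>2 < u \<and> \<bar>real i - real k\<bar> < 3 / 4 \<and> 1 / 2 < real i \<and>
        real i < real d + 1 / 2 \<longleftrightarrow> Beta k \<in> \<sigma>"
      using i by (auto simp: \<sigma> small)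
    show "(real i - real k)\<^sup>2 < u \<and> \<bar>real i - real k\<bar> < 1 / 2 \<longleftrightarrow> Gamma k \<in> \<sigma>"
      by (auto simp: \<sigma> small)
  qed
  have neg: "- 1 < y\<^sup>2" "\<not> y\<^sup>2 < - 1" for y :: real
    using zero_le_power2[of y] by linarith+
  from \<sigma> show ?thesis
  proof (cases rule: code_2dd_cases)
    case 1
    show ?thesis
    proof (rule plane_realizedI[of d 2 0])
      fix k assume "k \<in> {1..d}"
      show "(\<forall>j\<in>{0..d + 1} - {k}. 2 < (0 - real j)\<^sup>2) \<longleftrightarrow> Delta k \<in> \<sigma>"
        using no_delta[of 0 0 k] 1 by simp
    qed (auto simp: 1)
  next
    case (2 i)
    then have i: "1 \<le> i" "i \<le> d" by auto
    show ?thesis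
      by (rule chainI[of 0 i]) (use i in \<open>auto simp: 2(2)\<close>)
  next
    case (3 i)
    then have i: "1 \<le> i" "i + 1 \<le> d" by auto
    show ?thesis
      by (rule chainI[of "3 / 8" i]) (use i in \<open>auto simp: 3(2)\<close>)
  next
    case (4 i)
    then have i: "1 \<le> i" "i + 1 \<le> d" by auto
    show ?thesis
      by (rule chainI[of "1 / 2" i]) (use i in \<open>auto simp: 4(2)\<close>)
  next
    case (5 i)
    then have i: "1 \<le> i" "i + 1 \<le> d" by auto
    show ?thesis
      by (rule chainI[of "5 / 8" i]) (use i in \<open>auto simp: 5(2)\<close>)
  next
    case (6 i)
    then show ?thesis by (intro petalI[of "1 / 2" i]) auto
  next
    case (7 i)
    then show ?thesis by (intro petalI[of 0 i]) auto
  next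
    case 8
    show ?thesis
      by (rule plane_realizedI[of d "-1" 1]) (auto simp: 8 neg)
  next
    case 9
    show ?thesis
      by (rule plane_realizedI[of d "-1" 0]) (auto simp: 9 neg)
  qed
qed

lemma open_plane_realization:
  assumes "2 \<le> d"
  shows "open_convex_family 2 (base_2dd d) (\<lambda>s. topspace (Euclidean_space 2) \<inter> plane_set d s)"
    "code_of 2 (base_2dd d) (\<lambda>s. topspace (Euclidean_space 2) \<inter> plane_set d s) = code_2dd d"
proof -
  show "open_convex_family 2 (base_2dd d) (\<lambda>s. topspace (Euclidean_space 2) \<inter> plane_set d s)"
    unfolding open_convex_family_def seq_convex_iff_convex
    by (simp add: openin_Euclidean_space_Int open_plane_set convex_Int convex_plane_set
        convex_topspace_Euclidean_space)
  show "code_of 2 (base_2dd d) (\<lambda>s. topspace (Euclidean_space 2) \<inter> plane_set d s) = code_2dd d"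
    unfolding code_of_Int_topspace
    by (intro code_of_eqI code_2dd_subset_Pow plane_pattern plane_realized assms)
qed

section \<open>A closed non-degenerate realization in dimension \<open>d\<close>\<close>

text \<open>
  From an interior point, a small step along \<open>v\<close> or \<open>- v\<close> stays in \<open>X\<close> and increases \<open>\<phi>\<close>.
\<close>

lemma interior_of_halfspace:
  fixes \<phi> :: "(nat \<Rightarrow> real) \<Rightarrow> real"
  assumes p: "p \<in> Euclidean_space m interior_of X"
    and X: "\<And>q. q \<in> X \<Longrightarrow> \<phi> q \<le> c"
    and \<phi>: "linear \<phi>" and v: "v \<in> topspace (Euclidean_space m)" "\<phi> v \<noteq> 0"
  shows "\<phi> p < c"
proof -
  obtain T where T: "openin (Euclidean_space m) T" "p \<in> T" "T \<subseteq> X"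
    using p by (auto simp: interior_of_def)
  then obtain W where W: "open W" "T = topspace (Euclidean_space m) \<inter> W"
    by (subst (asm) Euclidean_space_eq_subtopology) (auto simp: openin_open)
  define w where "w = sgn (\<phi> v) *\<^sub>R v"
  have w: "w \<in> topspace (Euclidean_space m)" "0 < \<phi> w"
    using v subspace_Euclidean_space \<phi>
    by (auto simp: w_def subspace_scale linear_scale sgn_if)
  have "closed (- W)" "p \<notin> - W" using W T by auto
  then obtain s where s: "0 < s" "p + s *\<^sub>R (p + w - p) \<notin> - W"
    using segment_leaves_closed[of "- W" p "p + w"] by metis
  moreover have "p + s *\<^sub>R w \<in> topspace (Euclidean_space m)"
    using W T w subspace_Euclidean_space by (auto intro!: subspace_add subspace_scale)
  ultimately have "p + s *\<^sub>R w \<in> X" using W T by auto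
  then have "\<phi> p + s * \<phi> w \<le> c" using X \<phi> by (fastforce simp: linear_add linear_scale)
  then show ?thesis using s w by (smt (verit) mult_pos_pos)
qed

text \<open>
  The Boolean parameter allows the closed sets (weak inequalities) and their interiors (strict
  inequalities) to be treated by the same arguments.
\<close>

definition lt :: "bool \<Rightarrow> real \<Rightarrow> real \<Rightarrow> bool" where
  "lt strict a b \<longleftrightarrow> (if strict then a < b else a \<le> b)"

lemma lt_imp_le: "lt b x y \<Longrightarrow> x \<le> y"
  by (auto simp: lt_def split: if_splits)

lemma less_imp_lt: "x < y \<Longrightarrow> lt b x y"
  by (auto simp: lt_def)

lemma not_lt_imp_le: "\<not> lt b x y \<Longrightarrow> y \<le> x"
  by (auto simp: lt_def split: if_splits)

definition coord_sum :: "nat \<Rightarrow> (nat \<Rightarrow> real) \<Rightarrow> real" where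
  "coord_sum d p = (\<Sum>j<d. p j)"

definition position :: "nat \<Rightarrow> (nat \<Rightarrow> real) \<Rightarrow> real" where
  "position d p = (\<Sum>j<d. real (j + 1) * p j) / real d"

text \<open>
  Coordinate \<open>j\<close> belongs to the index \<open>j + 1\<close>. The half-space \<open>8 d - 1 \<le> coord_sum\<close> misses the cube
  \<open>[-1, 0]\<^sup>d\<close> and meets the \<open>i\<close>-th box only near its far end. There \<open>position\<close> is in
  \<open>[8 i - 1, 8 i]\<close>, well inside the range of \<open>B\<^sub>i\<close>. The
  ranges of \<open>B\<^sub>i\<close> and \<open>B\<^sub>i\<^sub>+\<^sub>1\<close> overlap in \<open>[8 i + 3, 8 i + 5]\<close>, and those of \<open>G\<^sub>i\<close> and \<open>G\<^sub>i\<^sub>+\<^sub>1\<close> reach into this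
  overlap by \<open>1 / 2\<close> from the two ends. The sets \<open>A\<^sub>i\<close> leave out the corner of the cube at
  \<open>(-1, \<dots>, -1)\<close>, which has no point in common with the prolonged parts of the boxes.
\<close>

fun slab_set :: "nat \<Rightarrow> bool \<Rightarrow> symb \<Rightarrow> (nat \<Rightarrow> real) set" where
  "slab_set d b (Delta i) = {p. \<forall>j\<in>{..<d}. lt b (- 1) (p j)} \<inter>
     {p. \<forall>j\<in>{..<d}. lt b (p j) (if j + 1 = i then 8 * real d else 0)}"
| "slab_set d b (Alpha i) = {p. \<forall>j\<in>{..<d}. lt b (- 1) (p j)} \<inter>
     {p. \<forall>j\<in>{..<d}. lt b (p j) (if j + 1 = i then 8 * real d else 0)} \<inter> {p. lt b (1 - real d) (coord_sum d p)}"
| "slab_set d b (Beta i) = {p. lt b (8 * real d - 1) (coord_sum d p)} \<inter>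
     {p. lt b (8 * real i - 5) (position d p)} \<inter> {p. lt b (position d p) (8 * real i + 5)} \<inter>
     {p. lt b 5 (position d p)} \<inter> {p. lt b (position d p) (8 * real d + 3)}"
| "slab_set d b (Gamma i) = {p. lt b (8 * real d - 1) (coord_sum d p)} \<inter>
     {p. lt b (8 * real i - 7 / 2) (position d p)} \<inter> {p. lt b (position d p) (8 * real i + 7 / 2)} \<inter>
     {p. lt b 5 (position d p)} \<inter> {p. lt b (position d p) (8 * real d + 3)}"

declare slab_set.simps [simp del]

lemma linear_coord_sum: "linear (coord_sum d)"
  by (rule linearI) (simp_all add: coord_sum_def scaleR_fun_def sum.distrib sum_distrib_left)

lemma linear_position: "linear (position d)"
  by (rule linearI)
     (simp_all add: position_def scaleR_fun_def sum.distrib sum_distrib_left ring_distribs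
       add_divide_distrib mult.left_commute)

lemma continuous_coord_sum: "continuous_on UNIV (coord_sum d)"
  unfolding coord_sum_def[abs_def] by (intro continuous_on_sum continuous_on_product_coordinates)

lemma continuous_position: "continuous_on UNIV (position d)"
  unfolding position_def[abs_def] divide_inverse
  by (intro continuous_on_mult_right continuous_on_sum continuous_on_mult_left
      continuous_on_product_coordinates)

lemma convex_slab_set: "convex (slab_set d b s)"
proof -
  have half: "convex {p. lt b c (\<phi> p)}" "convex {p. lt b (\<phi> p) c}"
    if "linear \<phi>" for \<phi> :: "(nat \<Rightarrow> real) \<Rightarrow> real" and c
    using convex_linear_Collect[OF that, of c] by (cases b; simp add: lt_def)+
  show ?thesis
    by (cases s; simp only: slab_set.simps Collect_ball_eq;
        intro convex_Int convex_INT half linear_coord_sum linear_position linear_coordinate)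
qed

lemma open_slab_set: "open (slab_set d True s)"
proof -
  have half: "open {p. lt True c (\<phi> p)}" "open {p. lt True (\<phi> p) c}"
    if "continuous_on UNIV \<phi>" for \<phi> :: "(nat \<Rightarrow> real) \<Rightarrow> real" and c
    using that by (simp_all add: lt_def open_Collect_less continuous_on_const)
  show ?thesis
    by (cases s; simp only: slab_set.simps Collect_ball_eq;
        intro open_Int open_INT ballI finite_lessThan half continuous_coord_sum continuous_position
          continuous_on_product_coordinates)
qed

lemma closed_slab_set: "closed (slab_set d False s)"
proof -
  have half: "closed {p. lt False c (\<phi> p)}" "closed {p. lt False (\<phi> p) c}"
    if "continuous_on UNIV \<phi>" for \<phi> :: "(nat \<Rightarrow> real) \<Rightarrow> real" and c
    using that by (simp_all add: lt_def closed_Collect_le continuous_on_const)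
  show ?thesis
    by (cases s; simp only: slab_set.simps Collect_ball_eq;
        intro closed_Int closed_INT ballI half continuous_coord_sum continuous_position
          continuous_on_product_coordinates)
qed

lemma slab_set_strict_subset: "slab_set d True s \<subseteq> slab_set d b s"
  "slab_set d b s \<subseteq> slab_set d False s"
proof -
  have mono: "lt True x y \<Longrightarrow> lt b x y" "lt b x y \<Longrightarrow> lt False x y" for x y
    by (auto simp: lt_def split: if_splits)
  show "slab_set d True s \<subseteq> slab_set d b s"
    by (cases s; simp only: slab_set.simps; blast intro: mono(1))
  show "slab_set d b s \<subseteq> slab_set d False s"
    by (cases s; simp only: slab_set.simps; blast intro: mono(2))
qed

text \<open>
  Each inequality of \<open>slab_set\<close> is given by a linear functional that is nonzero on some unit vector of
  \<open>\<real>\<^sup>d\<close>; hence it is strict at interior points.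
\<close>

lemma interior_of_slab_set:
  assumes "0 < d"
  defines "V \<equiv> topspace (Euclidean_space d)"
  shows "Euclidean_space d interior_of (V \<inter> slab_set d False s) = V \<inter> slab_set d True s"
proof
  show "V \<inter> slab_set d True s \<subseteq> Euclidean_space d interior_of (V \<inter> slab_set d False s)"
    unfolding V_def
    by (rule interior_of_maximal)
       (use slab_set_strict_subset(2)[of d True s] openin_Euclidean_space_Int[OF open_slab_set] in auto)
  show "Euclidean_space d interior_of (V \<inter> slab_set d False s) \<subseteq> V \<inter> slab_set d True s"
  proof
    fix p assume p: "p \<in> Euclidean_space d interior_of (V \<inter> slab_set d False s)"
    have "p \<in> V" using subsetD[OF interior_of_subset p] by simp
    define e where "e j = (\<lambda>i. if i = j then 1 else 0 :: real)" for j :: nat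
    have e: "e j \<in> topspace (Euclidean_space d)" if "j < d" for j
      using that by (simp add: e_def topspace_Euclidean_space)
    have upper: "lt True (\<phi> p) c"
      if "V \<inter> slab_set d False s \<subseteq> {q. lt False (\<phi> q) c}" "linear \<phi>" "j < d" "\<phi> (e j) \<noteq> 0" for \<phi> c j
    proof -
      have "\<phi> q \<le> c" if "q \<in> V \<inter> slab_set d False s" for q
        using subsetD[OF \<open>V \<inter> slab_set d False s \<subseteq> {q. lt False (\<phi> q) c}\<close> that] by (simp add: lt_def)
      from interior_of_halfspace[OF p this that(2) e[OF that(3)] that(4)]
      show ?thesis by (simp add: lt_def)
    qed
    have lower: "lt True c (\<phi> p)"
      if "V \<inter> slab_set d False s \<subseteq> {q. lt False c (\<phi> q)}" "linear \<phi>" "j < d" "\<phi> (e j) \<noteq> 0" for \<phi> c j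
    proof -
      have "V \<inter> slab_set d False s \<subseteq> {q. lt False (- \<phi> q) (- c)}" using that(1) by (simp add: lt_def)
      from upper[OF this linear_compose_neg[OF that(2)] that(3)] that(4)
      show ?thesis by (simp add: lt_def)
    qed
    have "(\<Sum>j<d. e 0 j) = 1" "(\<Sum>j<d. real (j + 1) * e 0 j) = 1"
      using assms(1) by (simp_all add: e_def if_distrib cong: if_cong)
    then have nonzero: "coord_sum d (e 0) \<noteq> 0" "position d (e 0) \<noteq> 0"
      using assms(1) by (simp_all add: coord_sum_def position_def)
    have coord: "e j j \<noteq> 0" for j by (simp add: e_def)
    have lin: "linear (\<lambda>q :: nat \<Rightarrow> real. q j)" for j by (rule linear_coordinate)
    note S = linear_coord_sum assms(1) nonzero(1) and L = linear_position assms(1) nonzero(2)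
    have "p \<in> slab_set d True s"
    proof (cases s)
      case (Alpha i)
      show ?thesis
        unfolding Alpha slab_set.simps Int_iff mem_Collect_eq
        by (intro conjI ballI upper[OF _ lin _ coord] lower[OF _ lin _ coord] lower[OF _ S])
           (auto simp: Alpha slab_set.simps)
    next
      case (Beta i)
      show ?thesis
        unfolding Beta slab_set.simps Int_iff mem_Collect_eq
        by (intro conjI lower[OF _ S] lower[OF _ L] upper[OF _ L]) (auto simp: Beta slab_set.simps)
    next
      case (Gamma i)
      show ?thesis
        unfolding Gamma slab_set.simps Int_iff mem_Collect_eq
        by (intro conjI lower[OF _ S] lower[OF _ L] upper[OF _ L]) (auto simp: Gamma slab_set.simps)
    next
      case (Delta i)
      show ?thesis
        unfolding Delta slab_set.simps Int_iff mem_Collect_eq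
        by (intro conjI ballI upper[OF _ lin _ coord] lower[OF _ lin _ coord])
           (auto simp: Delta slab_set.simps)
    qed
    with \<open>p \<in> V\<close> show "p \<in> V \<inter> slab_set d True s" by blast
  qed
qed

lemma slab_Delta_iff: "p \<in> slab_set d b (Delta i) \<longleftrightarrow>
    (\<forall>j<d. lt b (- 1) (p j) \<and> lt b (p j) (if j + 1 = i then 8 * real d else 0))"
  and slab_Alpha_iff: "p \<in> slab_set d b (Alpha i) \<longleftrightarrow>
    p \<in> slab_set d b (Delta i) \<and> lt b (1 - real d) (coord_sum d p)"
  and slab_Beta_iff: "p \<in> slab_set d b (Beta i) \<longleftrightarrow>
    lt b (8 * real d - 1) (coord_sum d p) \<and> lt b 5 (position d p) \<and> lt b (position d p) (8 * real d + 3) \<and>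
    lt b (8 * real i - 5) (position d p) \<and> lt b (position d p) (8 * real i + 5)"
  and slab_Gamma_iff: "p \<in> slab_set d b (Gamma i) \<longleftrightarrow>
    lt b (8 * real d - 1) (coord_sum d p) \<and> lt b 5 (position d p) \<and> lt b (position d p) (8 * real d + 3) \<and>
    lt b (8 * real i - 7 / 2) (position d p) \<and> lt b (position d p) (8 * real i + 7 / 2)"
  by (auto simp: slab_set.simps)

text \<open>
  All weights \<open>j + 1\<close> of \<open>d * position\<close> are between \<open>0\<close> and \<open>d\<close>, and all coordinates but the \<open>i\<close>-th are
  nonpositive. So \<open>d * position\<close> is bounded above by the \<open>i\<close>-th term alone, and the same
  reasoning with the weights \<open>j + 1 - d\<close> bounds \<open>d * position - d * coord_sum\<close> below.
\<close>

lemma petal_window: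
  assumes i: "i \<in> {1..d}" and p: "p \<in> slab_set d b (Delta i)" and S: "8 * real d - 1 \<le> coord_sum d p"
  shows "8 * real i - 1 \<le> position d p" "position d p \<le> 8 * real i"
proof -
  have p': "p j \<le> (if j + 1 = i then 8 * real d else 0)" if "j < d" for j
    using p that lt_imp_le unfolding slab_Delta_iff by blast
  have d: "0 < real d" using i by simp
  have single: "(\<Sum>j<d. if j + 1 = i then c else 0) = c" for c :: real
  proof -
    have "(\<Sum>j<d. if j + 1 = i then c else 0) = (\<Sum>j<d. if j = i - 1 then c else 0)"
      by (rule sum.cong) (use i in auto)
    moreover have "i - 1 < d" using i by auto
    ultimately show ?thesis by simp
  qed
  have scaled: "real d * position d p = (\<Sum>j<d. real (j + 1) * p j)"
    using d by (simp add: position_def)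
  have "(\<Sum>j<d. real (j + 1) * p j) \<le> (\<Sum>j<d. if j + 1 = i then real i * (8 * real d) else 0)"
  proof (rule sum_mono)
    fix j assume "j \<in> {..<d}"
    then have "real (j + 1) * p j \<le> real (j + 1) * (if j + 1 = i then 8 * real d else 0)"
      by (intro mult_left_mono p') auto
    then show "real (j + 1) * p j \<le> (if j + 1 = i then real i * (8 * real d) else 0)"
      by (cases "j + 1 = i") (auto simp only: simp_thms if_True if_False mult_zero_right)
  qed
  then have "(\<Sum>j<d. real (j + 1) * p j) \<le> real d * (8 * real i)"
    unfolding single by (simp only: ac_simps)
  then have "real d * position d p \<le> real d * (8 * real i)" by (simp only: scaled)
  then show "position d p \<le> 8 * real i" using d by simp
  have "(\<Sum>j<d. if j + 1 = i then (real i - real d) * (8 * real d) else 0) \<le> (\<Sum>j<d. (real (j + 1) - real d) * p j)"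
  proof (rule sum_mono)
    fix j assume j: "j \<in> {..<d}"
    then have "(real (j + 1) - real d) * (if j + 1 = i then 8 * real d else 0) \<le> (real (j + 1) - real d) * p j"
      by (intro mult_left_mono_neg p') auto
    then show "(if j + 1 = i then (real i - real d) * (8 * real d) else 0) \<le> (real (j + 1) - real d) * p j"
      by (cases "j + 1 = i") (auto simp only: simp_thms if_True if_False mult_zero_right)
  qed
  also have "\<dots> = real d * position d p - real d * coord_sum d p"
    unfolding scaled coord_sum_def by (simp add: left_diff_distrib sum_subtractf sum_distrib_left)
  finally have "real d * (8 * real i - 8 * real d + coord_sum d p) \<le> real d * position d p"
    unfolding single by (simp add: algebra_simps)
  then have "8 * real i - 8 * real d + coord_sum d p \<le> position d p" using d by simp
  then show "8 * real i - 1 \<le> position d p" using S by linarith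
qed

text \<open>
  This is why the corner that \<open>A\<^sub>i\<close> leaves out belongs to the cube: the other \<open>d - 1\<close> coordinates
  are at least \<open>-1\<close>, so a coordinate sum below \<open>1 - d\<close> forces the \<open>i\<close>-th one to be negative. For the
  strict version, the two kinds of inequality change places.
\<close>

lemma Delta_not_Alpha_nonpos:
  assumes d: "2 \<le> d" and i: "i \<in> {1..d}" and p: "p \<in> slab_set d b (Delta i)" "p \<notin> slab_set d b (Alpha i)"
  shows "lt b (p (i - 1)) 0"
proof -
  have S: "\<not> lt b (1 - real d) (coord_sum d p)" using p by (simp add: slab_Alpha_iff)
  have low: "lt b (- 1) (p j)" if "j < d" for j using p(1) that by (simp add: slab_Delta_iff)
  define J where "J = {..<d} - {i - 1}"
  have "i - 1 \<in> {..<d}" using i by auto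
  then have J: "finite J" "card J = d - 1" by (simp_all add: J_def)
  have sum: "coord_sum d p = p (i - 1) + sum p J"
    unfolding coord_sum_def J_def by (rule sum.remove) (use i in auto)
  have card: "(\<Sum>j\<in>J. - 1 :: real) = 1 - real d" using J d by (simp add: of_nat_diff)
  show ?thesis
  proof (cases b)
    case True
    have "J \<noteq> {}" using J d by auto
    then have "(\<Sum>j\<in>J. - 1) < sum p J"
      using J low by (intro sum_strict_mono) (auto simp: J_def True lt_def)
    then show ?thesis using S sum card by (simp add: True lt_def)
  next
    case False
    have "(\<Sum>j\<in>J. - 1) \<le> sum p J"
      using low by (intro sum_mono) (auto simp: J_def False lt_def)
    then show ?thesis using S sum card by (simp add: False lt_def)
  qed
qed

lemma lt_weaken: "lt b x y \<Longrightarrow> y \<le> z \<Longrightarrow> lt b x z"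
  by (auto simp: lt_def split: if_splits)

lemma slab_pattern:
  assumes d: "2 \<le> d"
  shows "{s \<in> base_2dd d. p \<in> slab_set d b s} \<in> code_2dd d"
proof -
  define S where "S = coord_sum d p"
  define L where "L = position d p"
  note betaD = slab_Beta_iff[of p d b, folded S_def L_def]
  note gammaD = slab_Gamma_iff[of p d b, folded S_def L_def]
  have beta_window: "8 * real i - 5 \<le> L" "L \<le> 8 * real i + 5" "5 \<le> L" "L \<le> 8 * real d + 3" "8 * real d - 1 \<le> S"
    if "p \<in> slab_set d b (Beta i)" for i
    using that lt_imp_le unfolding betaD by blast+
  have gamma_window: "8 * real i - 7 / 2 \<le> L" "L \<le> 8 * real i + 7 / 2"
    if "p \<in> slab_set d b (Gamma i)" for i
    using that lt_imp_le unfolding gammaD by blast+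
  have delta_all: "p \<in> slab_set d b (Delta k)"
    if "p \<in> slab_set d b (Delta i)" "i \<in> {1..d}" "lt b (p (i - 1)) 0" for i k
    unfolding slab_Delta_iff
  proof (intro allI impI conjI)
    fix j assume j: "j < d"
    show "lt b (- 1) (p j)" using that(1) j by (simp add: slab_Delta_iff)
    have "lt b (p j) 0"
    proof (cases "j + 1 = i")
      case True
      then show ?thesis using that(3) by auto
    next
      case False
      then show ?thesis using that(1)[unfolded slab_Delta_iff, rule_format, OF j] by simp
    qed
    then show "lt b (p j) (if j + 1 = k then 8 * real d else 0)"
      by (auto intro: lt_weaken)
  qed
  show ?thesis
  proof (rule codeword_2ddI[OF d], goal_cases)
    case (3 i j k)
    then have i: "i \<in> {1..d}" "p \<in> slab_set d b (Delta i)" "p \<in> slab_set d b (Delta j)" by simp_all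
    have "lt b (p (i - 1)) (if i - 1 + 1 = j then 8 * real d else 0)"
    proof -
      have "i - 1 < d" using i(1) by auto
      then show ?thesis using i(3) unfolding slab_Delta_iff by blast
    qed
    then have "lt b (p (i - 1)) 0" using i(1) 3(3) by simp
    then show ?case using delta_all[OF i(2,1)] 3(4) by simp
  next
    case (5 i j)
    then have "i \<in> {1..d}" "p \<in> slab_set d b (Delta i)" "p \<notin> slab_set d b (Alpha i)" by simp_all
    then show ?case using delta_all[of i j] Delta_not_Alpha_nonpos[OF d] 5(3) by simp
  next
    case (6 i j)
    then have ij: "p \<in> slab_set d b (Beta i)" "j \<in> {1..d}" "p \<in> slab_set d b (Delta j)" by simp_all
    have "8 * real j - 1 \<le> L" "L \<le> 8 * real j"
      using petal_window[OF ij(2,3)] beta_window(5)[OF ij(1)] by (simp_all add: S_def L_def)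
    then show ?case using beta_window(1,2)[OF ij(1)] by linarith
  next
    case (7 i)
    then have "p \<in> slab_set d b (Gamma i)" "i \<in> {1..d}" by simp_all
    then show ?case
      using less_imp_lt[of "8 * real i - 5" L b] less_imp_lt[of L "8 * real i + 5" b] gamma_window[of i]
      by (simp add: betaD gammaD)
  next
    case (8 i j)
    then show ?case using gamma_window[of i] gamma_window[of j] by simp
  next
    case (9 i j)
    then show ?case using beta_window(1,2)[of i] beta_window(1,2)[of j] by simp
  next
    case (10 i)
    then have i: "1 \<le> i" "i \<le> d" "p \<in> slab_set d b (Beta i)" by simp_all
    note w = beta_window[OF i(3)]
    have b: "lt b (8 * real d - 1) S" "lt b 5 L" "lt b L (8 * real d + 3)"
      using i(3) by (simp_all add: betaD)
    consider "p \<in> slab_set d b (Gamma i)" | "8 * real i + 7 / 2 \<le> L" | "L \<le> 8 * real i - 7 / 2"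
      using b not_lt_imp_le unfolding gammaD by blast
    then show ?case
    proof cases
      case 1
      then show ?thesis using i by simp
    next
      case 2
      then have "i < d" using w by linarith
      moreover have "lt b (8 * real (i + 1) - 5) L" "lt b L (8 * real (i + 1) + 5)"
        using 2 w by (auto intro!: less_imp_lt)
      ultimately have "Beta (i + 1) \<in> {s \<in> base_2dd d. p \<in> slab_set d b s}"
        using i b by (simp add: betaD)
      then show ?thesis using \<open>i < d\<close> by blast
    next
      case 3
      then have "1 < i" using w by linarith
      then have "real (i - 1) = real i - 1" by (simp add: of_nat_diff)
      then have "lt b (8 * real (i - 1) - 5) L" "lt b L (8 * real (i - 1) + 5)"
        using 3 w by (auto intro!: less_imp_lt)
      moreover have "i - 1 \<in> {1..d}" using \<open>1 < i\<close> i by auto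
      ultimately have "Beta (i - 1) \<in> {s \<in> base_2dd d. p \<in> slab_set d b s}"
        using b by (simp only: mem_Collect_eq base_2dd_mem betaD simp_thms)
      then show ?thesis using \<open>1 < i\<close> by blast
    qed
  qed (auto simp: slab_Alpha_iff)
qed

text \<open>
  The next lemmas provide points for the codewords. Such a point satisfies the strict inequalities of
  the sets it belongs to and violates the weak ones of all the others, so it serves for the closed
  sets and for their interiors. The first two coordinates suffice to prescribe \<open>coord_sum\<close>
  and \<open>position\<close>.
\<close>

lemma slab_chain_point:
  fixes c :: real
  assumes d: "2 \<le> d" and c: "0 < c" "c < 5" and i: "i \<in> {1..d}" "i = d \<Longrightarrow> c < 3"
    and \<sigma>: "\<And>k. Delta k \<notin> \<sigma>" "\<And>k. Alpha k \<notin> \<sigma>"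
      "\<And>k. Beta k \<in> \<sigma> \<longleftrightarrow> k = i \<or> k = i + 1 \<and> 3 < c" "c \<noteq> 3"
      "\<And>k. Gamma k \<in> \<sigma> \<longleftrightarrow> k = i \<and> c < 7 / 2 \<or> k = i + 1 \<and> 9 / 2 < c" "c \<noteq> 7 / 2" "c \<noteq> 9 / 2"
  shows "\<exists>p\<in>topspace (Euclidean_space d). \<forall>s\<in>base_2dd d.
    (s \<in> \<sigma> \<longrightarrow> p \<in> slab_set d True s) \<and> (s \<notin> \<sigma> \<longrightarrow> p \<notin> slab_set d False s)"
proof
  define L where "L = 8 * real i + c"
  define S where "S = 8 * real d"
  define p where "p j = (if j = 0 then 2 * S - real d * L else if j = 1 then real d * L - S else 0)" for j :: nat
  show "p \<in> topspace (Euclidean_space d)"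
    using d by (auto simp: p_def topspace_Euclidean_space)
  have two: "(\<Sum>j<d. f j * p j) = f 0 * p 0 + f 1 * p 1" for f :: "nat \<Rightarrow> real"
  proof -
    have "(\<Sum>j<d. f j * p j) = (\<Sum>j\<in>{0, 1}. f j * p j)"
      by (rule sum.mono_neutral_right) (use d in \<open>auto simp: p_def\<close>)
    then show ?thesis by simp
  qed
  have pS: "coord_sum d p = S"
    using two[of "\<lambda>_. 1"] by (simp add: coord_sum_def p_def)
  have pL: "position d p = L"
    using two[of "\<lambda>j. real (j + 1)"] d by (simp add: position_def p_def field_simps)
  have dist: "\<bar>L - 8 * real k\<bar> < e \<longleftrightarrow> k = i \<and> c < e \<or> k = i + 1 \<and> 8 - c < e"
      "\<bar>L - 8 * real k\<bar> \<le> e \<longleftrightarrow> k = i \<and> c \<le> e \<or> k = i + 1 \<and> 8 - c \<le> e" if "e \<le> 5" for k e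
  proof -
    consider "k < i" | "k = i" | "k = i + 1" | "i + 1 < k" by linarith
    then have "(\<bar>L - 8 * real k\<bar> < e \<longleftrightarrow> k = i \<and> c < e \<or> k = i + 1 \<and> 8 - c < e) \<and>
      (\<bar>L - 8 * real k\<bar> \<le> e \<longleftrightarrow> k = i \<and> c \<le> e \<or> k = i + 1 \<and> 8 - c \<le> e)"
    proof cases
      case 1
      then have "real k + 1 \<le> real i" by linarith
      then show ?thesis using 1 that c by (auto simp: L_def)
    next
      case 4
      then have "real i + 2 \<le> real k" by linarith
      then show ?thesis using 4 that c by (auto simp: L_def)
    qed (use c in \<open>auto simp: L_def\<close>)
    then show "\<bar>L - 8 * real k\<bar> < e \<longleftrightarrow> k = i \<and> c < e \<or> k = i + 1 \<and> 8 - c < e"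
      "\<bar>L - 8 * real k\<bar> \<le> e \<longleftrightarrow> k = i \<and> c \<le> e \<or> k = i + 1 \<and> 8 - c \<le> e" by blast+
  qed
  have range: "5 < L" "L < 8 * real d + 3"
  proof -
    have "1 \<le> real i" using i by simp
    then show "5 < L" using c by (simp add: L_def)
    show "L < 8 * real d + 3"
    proof (cases "i = d")
      case True
      then show ?thesis using i by (simp add: L_def)
    next
      case False
      then have "real i + 1 \<le> real d" using i by simp
      then show ?thesis using c by (simp add: L_def)
    qed
  qed
  have noD: "p \<notin> slab_set d b (Delta k)" if "k \<in> {1..d}" for b k
  proof
    assume "p \<in> slab_set d b (Delta k)"
    from petal_window[OF that this] have "8 * real k - 1 \<le> L" "L \<le> 8 * real k"
      by (simp_all add: pS pL S_def)
    then have "8 * real k - 1 \<le> 8 * real i + c" "8 * real i + c \<le> 8 * real k" by (simp_all add: L_def)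
    then have "i < k" "k < i + 1" using c by linarith+
    then show False by simp
  qed
  show "\<forall>s\<in>base_2dd d. (s \<in> \<sigma> \<longrightarrow> p \<in> slab_set d True s) \<and> (s \<notin> \<sigma> \<longrightarrow> p \<notin> slab_set d False s)"
  proof
    fix s assume s: "s \<in> base_2dd d"
    show "(s \<in> \<sigma> \<longrightarrow> p \<in> slab_set d True s) \<and> (s \<notin> \<sigma> \<longrightarrow> p \<notin> slab_set d False s)"
    proof (cases s)
      case (Alpha k)
      then show ?thesis using s noD[of k] \<sigma>(2) by (simp add: slab_Alpha_iff)
    next
      case (Beta k)
      have near: "Beta k \<in> \<sigma> \<Longrightarrow> \<bar>L - 8 * real k\<bar> < 5" "Beta k \<notin> \<sigma> \<Longrightarrow> \<not> \<bar>L - 8 * real k\<bar> \<le> 5"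
        using dist[of 5 k] \<sigma>(3)[of k] c \<sigma>(4) by auto
      show ?thesis
        unfolding Beta slab_Beta_iff pS pL lt_def S_def
        using near[unfolded abs_less_iff abs_le_iff] range by auto
    next
      case (Gamma k)
      have near: "Gamma k \<in> \<sigma> \<Longrightarrow> \<bar>L - 8 * real k\<bar> < 7 / 2" "Gamma k \<notin> \<sigma> \<Longrightarrow> \<not> \<bar>L - 8 * real k\<bar> \<le> 7 / 2"
        using dist[of "7 / 2" k] \<sigma>(5)[of k] \<sigma>(6,7) by auto
      show ?thesis
        unfolding Gamma slab_Gamma_iff pS pL lt_def S_def abs_less_iff abs_le_iff
        using near[unfolded abs_less_iff abs_le_iff] range by auto
    next
      case (Delta k)
      then show ?thesis using s noD[of k] \<sigma>(1) by simp
    qed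
  qed
qed

lemma slab_petal_point:
  fixes a e :: real
  assumes d: "2 \<le> d" and i: "i \<in> {1..d}"
    and e: "- 1 < e" "e < 0" and a: "0 < a" "a < 8 * real d"
    and S: "1 - real d < a + (real d - 1) * e" "a + (real d - 1) * e \<noteq> 8 * real d - 1"
    and \<sigma>: "\<And>k. Delta k \<in> \<sigma> \<longleftrightarrow> k = i" "\<And>k. Alpha k \<in> \<sigma> \<longleftrightarrow> k = i"
      "\<And>k. Beta k \<in> \<sigma> \<longleftrightarrow> k = i \<and> 8 * real d - 1 < a + (real d - 1) * e"
      "\<And>k. Gamma k \<in> \<sigma> \<longleftrightarrow> k = i \<and> 8 * real d - 1 < a + (real d - 1) * e"
  shows "\<exists>p\<in>topspace (Euclidean_space d). \<forall>s\<in>base_2dd d.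
    (s \<in> \<sigma> \<longrightarrow> p \<in> slab_set d True s) \<and> (s \<notin> \<sigma> \<longrightarrow> p \<notin> slab_set d False s)"
proof
  define p where "p j = (if j < d then if j + 1 = i then a else e else 0)" for j :: nat
  define s0 where "s0 = a + (real d - 1) * e"
  show "p \<in> topspace (Euclidean_space d)"
    by (simp add: p_def topspace_Euclidean_space)
  have i1: "i - 1 \<in> {..<d}" "i - 1 + 1 = i" using i by auto
  have "coord_sum d p = p (i - 1) + sum p ({..<d} - {i - 1})"
    unfolding coord_sum_def by (rule sum.remove) (use i1 in auto)
  also have "sum p ({..<d} - {i - 1}) = (\<Sum>j\<in>{..<d} - {i - 1}. e)"
    by (rule sum.cong) (use i in \<open>auto simp: p_def\<close>)
  also have "\<dots> = (real d - 1) * e" using i1 d by (simp add: of_nat_diff)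
  also have "p (i - 1) = a" using i1 by (simp add: p_def)
  finally have pS: "coord_sum d p = s0" by (simp add: s0_def)
  have D: "p \<in> slab_set d True (Delta i)"
    unfolding slab_Delta_iff using e a by (auto simp: p_def lt_def)
  have A: "p \<in> slab_set d True (Alpha i)"
    unfolding slab_Alpha_iff pS using D S by (simp add: s0_def lt_def)
  have noD: "p \<notin> slab_set d False (Delta k)" if "k \<noteq> i" for k
  proof
    assume "p \<in> slab_set d False (Delta k)"
    then have "p (i - 1) \<le> (if i - 1 + 1 = k then 8 * real d else 0)"
      using i1 unfolding slab_Delta_iff lt_def by auto
    moreover have "p (i - 1) = a" using i1 by (simp add: p_def)
    ultimately show False using that a i1 by simp
  qed
  show "\<forall>s\<in>base_2dd d. (s \<in> \<sigma> \<longrightarrow> p \<in> slab_set d True s) \<and> (s \<notin> \<sigma> \<longrightarrow> p \<notin> slab_set d False s)"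
  proof (cases "8 * real d - 1 < s0")
    case True
    have w: "8 * real i - 1 \<le> position d p" "position d p \<le> 8 * real i"
      using petal_window[OF i D] True pS by auto
    have r: "5 < position d p" "position d p < 8 * real d + 3"
    proof -
      have "1 \<le> real i" "real i \<le> real d" using i by simp_all
      then show "5 < position d p" "position d p < 8 * real d + 3" using w by linarith+
    qed
    have far: "\<not> (8 * real k - 5 \<le> position d p \<and> position d p \<le> 8 * real k + 5)" if "k \<noteq> i" for k
    proof -
      have "k < i \<or> i < k" using that by linarith
      then consider "real k + 1 \<le> real i" | "real i + 1 \<le> real k" by linarith
      then show ?thesis using w by cases linarith+
    qed
    have B: "p \<in> slab_set d True (Beta i)" "p \<in> slab_set d True (Gamma i)"
      unfolding slab_Beta_iff slab_Gamma_iff pS lt_def using True w r by simp_all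
    have noB: "p \<notin> slab_set d False (Beta k)" if "k \<noteq> i" for k
      unfolding slab_Beta_iff pS lt_def using far[OF that] by simp
    have noG: "p \<notin> slab_set d False (Gamma k)" if "k \<noteq> i" for k
      unfolding slab_Gamma_iff pS lt_def using far[OF that] by auto
    show ?thesis
    proof
      fix s show "(s \<in> \<sigma> \<longrightarrow> p \<in> slab_set d True s) \<and> (s \<notin> \<sigma> \<longrightarrow> p \<notin> slab_set d False s)"
        by (cases s) (use D A noD B noB noG True in \<open>auto simp: \<sigma> s0_def slab_Alpha_iff\<close>)
    qed
  next
    case False
    then have "s0 < 8 * real d - 1" using S by (simp add: s0_def)
    then have no: "p \<notin> slab_set d False (Beta k)" "p \<notin> slab_set d False (Gamma k)" for k
      unfolding slab_Beta_iff slab_Gamma_iff pS lt_def by simp_all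
    show ?thesis
    proof
      fix s show "(s \<in> \<sigma> \<longrightarrow> p \<in> slab_set d True s) \<and> (s \<notin> \<sigma> \<longrightarrow> p \<notin> slab_set d False s)"
        by (cases s) (use D A noD no False in \<open>auto simp: \<sigma> s0_def slab_Alpha_iff\<close>)
    qed
  qed
qed

lemma slab_diagonal_point:
  fixes e :: real
  assumes d: "2 \<le> d" and e: "e < 0" "e \<noteq> - 1" "real d * e \<noteq> 1 - real d"
    and \<sigma>: "\<And>k. k \<in> {1..d} \<Longrightarrow> Delta k \<in> \<sigma> \<longleftrightarrow> - 1 < e"
      "\<And>k. k \<in> {1..d} \<Longrightarrow> Alpha k \<in> \<sigma> \<longleftrightarrow> - 1 < e \<and> 1 - real d < real d * e"
      "\<And>k. Beta k \<notin> \<sigma>" "\<And>k. Gamma k \<notin> \<sigma>"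
  shows "\<exists>p\<in>topspace (Euclidean_space d). \<forall>s\<in>base_2dd d.
    (s \<in> \<sigma> \<longrightarrow> p \<in> slab_set d True s) \<and> (s \<notin> \<sigma> \<longrightarrow> p \<notin> slab_set d False s)"
proof
  define p where "p j = (if j < d then e else 0)" for j :: nat
  show "p \<in> topspace (Euclidean_space d)"
    by (simp add: p_def topspace_Euclidean_space)
  have pS: "coord_sum d p = real d * e" by (simp add: coord_sum_def p_def)
  have "real d * e < 8 * real d - 1"
  proof -
    have "real d * e \<le> 0" using e by (simp add: mult_nonneg_nonpos)
    then show ?thesis using d by simp
  qed
  then have no: "p \<notin> slab_set d False (Beta k)" "p \<notin> slab_set d False (Gamma k)" for k
    unfolding slab_Beta_iff slab_Gamma_iff pS lt_def by simp_all
  have D: "- 1 < e \<Longrightarrow> p \<in> slab_set d True (Delta k)" "\<not> - 1 < e \<Longrightarrow> p \<notin> slab_set d False (Delta k)" for k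
    unfolding slab_Delta_iff lt_def using e d by (auto simp: p_def intro!: exI[of _ 0])
  show "\<forall>s\<in>base_2dd d. (s \<in> \<sigma> \<longrightarrow> p \<in> slab_set d True s) \<and> (s \<notin> \<sigma> \<longrightarrow> p \<notin> slab_set d False s)"
  proof
    fix s assume s: "s \<in> base_2dd d"
    show "(s \<in> \<sigma> \<longrightarrow> p \<in> slab_set d True s) \<and> (s \<notin> \<sigma> \<longrightarrow> p \<notin> slab_set d False s)"
    proof (cases s)
      case (Alpha k)
      then show ?thesis using s D[of k] \<sigma>(2)[of k] e(3) by (auto simp: slab_Alpha_iff pS lt_def)
    next
      case (Delta k)
      then show ?thesis using s D[of k] \<sigma>(1)[of k] by auto
    qed (use no \<sigma>(3,4) in auto)
  qed
qed

lemma slab_realized: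
  assumes d: "2 \<le> d" and \<sigma>: "\<sigma> \<in> code_2dd d"
  shows "\<exists>p\<in>topspace (Euclidean_space d). \<forall>s\<in>base_2dd d.
    (s \<in> \<sigma> \<longrightarrow> p \<in> slab_set d True s) \<and> (s \<notin> \<sigma> \<longrightarrow> p \<notin> slab_set d False s)"
  using \<sigma>
proof (cases rule: code_2dd_cases)
  case 1
  show ?thesis
    by (rule slab_diagonal_point[OF d, of "- 2"]) (use d in \<open>auto simp: 1\<close>)
next
  case (2 i)
  show ?thesis
    by (rule slab_chain_point[OF d, of 1 i]) (use 2(1) in \<open>auto simp: 2(2)\<close>)
next
  case (3 i)
  show ?thesis
    by (rule slab_chain_point[OF d, of "13 / 4" i]) (use 3(1) in \<open>auto simp: 3(2)\<close>)
next
  case (4 i)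
  show ?thesis
    by (rule slab_chain_point[OF d, of 4 i]) (use 4(1) in \<open>auto simp: 4(2)\<close>)
next
  case (5 i)
  show ?thesis
    by (rule slab_chain_point[OF d, of "19 / 4" i]) (use 5(1) in \<open>auto simp: 5(2)\<close>)
next
  case (6 i)
  define e where "e = - 1 / (4 * real d)"
  have de: "real d * e = - 1 / 4" and e: "- 1 < e" "e < 0"
    using d by (simp_all add: e_def)
  then have S: "8 * real d - 1 < 8 * real d - 1 / 4 + (real d - 1) * e"
    by (simp add: left_diff_distrib)
  show ?thesis
    by (rule slab_petal_point[OF d 6(1) e, of "8 * real d - 1 / 4"])
       (use S d in \<open>simp_all add: 6(2)\<close>)
next
  case (7 i)
  have "2 \<le> real d" using d by simp
  then have "1 + (real d - 1) * (- 1 / 2) < 8 * real d - 1" "1 - real d < 1 + (real d - 1) * (- 1 / 2)"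
    by (simp_all add: field_simps)
  then show ?thesis
    by (intro slab_petal_point[OF d 7(1), of "- 1 / 2" 1]) (use d in \<open>auto simp: 7(2)\<close>)
next
  case 8
  show ?thesis
    by (rule slab_diagonal_point[OF d, of "- 1 / 4"]) (use d in \<open>auto simp: 8\<close>)
next
  case 9
  define e where "e = 1 / (2 * real d) - 1"
  have de: "real d * e = 1 / 2 - real d" and e: "- 1 < e" "e < 0"
    using d by (simp_all add: e_def field_simps)
  show ?thesis
    by (rule slab_diagonal_point[OF d e(2)]) (use e de in \<open>auto simp: 9\<close>)
qed

lemma code_of_slab_set:
  assumes "2 \<le> d"
  shows "code_of d (base_2dd d) (slab_set d b) = code_2dd d"
proof (intro code_of_eqI code_2dd_subset_Pow slab_pattern assms)
  fix \<sigma> assume "\<sigma> \<in> code_2dd d"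
  then show "\<exists>p\<in>topspace (Euclidean_space d). \<forall>s\<in>base_2dd d. p \<in> slab_set d b s \<longleftrightarrow> s \<in> \<sigma>"
    using slab_realized[OF assms] slab_set_strict_subset(1)[of d _ b] slab_set_strict_subset(2)[of d b] by (meson subsetD)
qed

lemma closed_slab_realization:
  assumes d: "2 \<le> d"
  defines "X \<equiv> \<lambda>s. topspace (Euclidean_space d) \<inter> slab_set d False s"
  shows "closed_convex_family d (base_2dd d) X"
    "code_of d (base_2dd d) X = code_2dd d"
    "closed_nondegenerate d (base_2dd d) X"
proof -
  show "closed_convex_family d (base_2dd d) X"
    unfolding closed_convex_family_def seq_convex_iff_convex X_def
    by (simp add: closedin_Euclidean_space_iff closed_Int closed_slab_set convex_Int
        convex_slab_set convex_topspace_Euclidean_space closed_topspace_Euclidean_space)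
  show code: "code_of d (base_2dd d) X = code_2dd d"
    by (simp add: X_def code_of_Int_topspace code_of_slab_set d)
  have "Euclidean_space d interior_of X s = topspace (Euclidean_space d) \<inter> slab_set d True s" for s
    unfolding X_def using d by (intro interior_of_slab_set) simp
  then show "closed_nondegenerate d (base_2dd d) X"
    unfolding closed_nondegenerate_def code
    by (simp add: code_of_Int_topspace code_of_slab_set d)
qed

section \<open>The embedding dimension vector\<close>

lemma Inf_enat_eqI:
  assumes "P m" "\<And>n. P n \<Longrightarrow> m \<le> n"
  shows "Inf {enat n | n. P n} = enat m"
  by (rule antisym) (use assms in \<open>auto intro!: Inf_lower Inf_greatest\<close>)

theorem theorem3p8:
  fixes d :: nat
  assumes "2 \<le> d"
  shows "embedding_dim_vector (base_2dd d) (code_2dd d) = (2, enat d, enat d)"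
proof -
  have "odim (base_2dd d) (code_2dd d) = enat 2"
    unfolding odim_def
  proof (rule Inf_enat_eqI)
    show "\<exists>U. open_convex_family 2 (base_2dd d) U \<and> code_of 2 (base_2dd d) U = code_2dd d"
      using open_plane_realization[OF assms] by blast
    show "2 \<le> m" if "\<exists>U. open_convex_family m (base_2dd d) U \<and> code_of m (base_2dd d) U = code_2dd d" for m
      using that convex_realization_dim_ge_2[OF assms]
      by (auto simp: open_convex_family_def seq_convex_iff_convex)
  qed
  moreover have "cdim (base_2dd d) (code_2dd d) = enat d"
    unfolding cdim_def
  proof (rule Inf_enat_eqI)
    show "\<exists>X. closed_convex_family d (base_2dd d) X \<and> code_of d (base_2dd d) X = code_2dd d"
      using closed_slab_realization[OF assms] by blast
    show "d \<le> m" if "\<exists>X. closed_convex_family m (base_2dd d) X \<and> code_of m (base_2dd d) X = code_2dd d" for m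
      using that closed_realization_dim[OF assms] by blast
  qed
  moreover have "nddim (base_2dd d) (code_2dd d) = enat d"
    unfolding nddim_def
  proof (rule Inf_enat_eqI)
    show "(\<exists>U. open_convex_family d (base_2dd d) U \<and> open_nondegenerate d (base_2dd d) U \<and>
          code_of d (base_2dd d) U = code_2dd d) \<or>
        (\<exists>X. closed_convex_family d (base_2dd d) X \<and> closed_nondegenerate d (base_2dd d) X \<and>
          code_of d (base_2dd d) X = code_2dd d)"
      using closed_slab_realization[OF assms] by blast
    show "d \<le> m"
      if "(\<exists>U. open_convex_family m (base_2dd d) U \<and> open_nondegenerate m (base_2dd d) U \<and>
          code_of m (base_2dd d) U = code_2dd d) \<or>
        (\<exists>X. closed_convex_family m (base_2dd d) X \<and> closed_nondegenerate m (base_2dd d) X \<and>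
          code_of m (base_2dd d) X = code_2dd d)" for m
      using that
    proof (elim disjE exE conjE)
      fix U assume U: "open_convex_family m (base_2dd d) U" "open_nondegenerate m (base_2dd d) U"
        "code_of m (base_2dd d) U = code_2dd d"
      from closed_realization_dim[OF assms closed_convex_family_closure[OF U(1)]] U(2,3)
      show "d \<le> m" by (simp add: open_nondegenerate_def)
    next
      fix X assume "closed_convex_family m (base_2dd d) X" "code_of m (base_2dd d) X = code_2dd d"
      then show "d \<le> m" by (rule closed_realization_dim[OF assms])
    qed
  qed
  ultimately show ?thesis
    by (simp add: embedding_dim_vector_def numeral_eq_enat)
qed

end
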